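(* Let $n\ge 2$, $b>0$, and let $p_0,\dots,p_{n-2}$ be complex-valued, $C^\infty$, $b$-periodic functions on $\mathbb{R}$. Consider $\mathcal{L}u := u^{(n)}+\sum_{k=0}^{n-2}p_k(x)u^{(k)}$ and the equation $\mathcal{L}u=\lambda u$, $\lambda\in\mathbb{C}$. Let $u_1(x;\lambda),\dots,u_n(x;\lambda)$ be the fundamental solutions, i.e. the solutions with $u_j^{(i-1)}(0;\lambda)=\delta_{ij}$ for $i,j=1,\dots,n$, let $T(\lambda)=[t_{ij}(\lambda)]_{1\le i,j\le n}$ with $t_{ij}(\lambda)=u_j^{(i-1)}(b;\lambda)$ (the Floquet matrix), and let $P(r;\lambda)=\det[rI-T(\lambda)]$. Then $P(r;\lambda)$, regarded as a polynomial in $r$ whose coefficients are entire functions of $\lambda$, is irreducible over the field $\mathcal{M}(\mathbb{C})$ of meromorphic functions on $\mathbb{C}$.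
   Context: Here $u^{(k)}$ denotes the $k$-th derivative in $x$. The entries $t_{ij}(\lambda)$ are entire functions of $\lambda$, so $P(r;\lambda)\in\mathcal{M}(\mathbb{C})[r]$ is monic of degree $n$. *)

theory Defs
  imports "HOL-Complex_Analysis.Complex_Analysis" "Jordan_Normal_Form.Char_Poly"
begin

definition vderiv :: "nat \<Rightarrow> (real \<Rightarrow> complex) \<Rightarrow> real \<Rightarrow> complex" where
  "vderiv k f = ((\<lambda>g x. vector_derivative g (at x)) ^^ k) f"

definition smooth_fun :: "(real \<Rightarrow> complex) \<Rightarrow> bool" where
  "smooth_fun f \<longleftrightarrow> (\<forall>k x. (vderiv k f has_vector_derivative vderiv (Suc k) f x) (at x))"

definition differentiable_n :: "nat \<Rightarrow> (real \<Rightarrow> complex) \<Rightarrow> bool" where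
  "differentiable_n n f \<longleftrightarrow> (\<forall>k<n. \<forall>x. (vderiv k f has_vector_derivative vderiv (Suc k) f x) (at x))"

text \<open>Polynomials in r over the field of meromorphic functions on C, represented by
  their value at each \<lambda>: every coefficient is meromorphic on C and degrees are bounded.
  Two such are equal in M(C)[r] iff they agree off a discrete set.\<close>
definition mero_poly :: "(complex \<Rightarrow> complex poly) \<Rightarrow> bool" where
  "mero_poly Q \<longleftrightarrow> (\<forall>k. (\<lambda>z. coeff (Q z) k) meromorphic_on UNIV) \<and> (\<exists>N. \<forall>z. degree (Q z) \<le> N)"

definition mero_deg_pos :: "(complex \<Rightarrow> complex poly) \<Rightarrow> bool" where
  "mero_deg_pos Q \<longleftrightarrow> (\<exists>k\<ge>1. \<not> (\<forall>\<^sub>\<approx>z. coeff (Q z) k = 0))"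

definition mero_irreducible :: "(complex \<Rightarrow> complex poly) \<Rightarrow> bool" where
  "mero_irreducible P \<longleftrightarrow> mero_poly P \<and> mero_deg_pos P \<and>
     \<not> (\<exists>Q R. mero_poly Q \<and> mero_poly R \<and> mero_deg_pos Q \<and> mero_deg_pos R \<and>
            (\<forall>\<^sub>\<approx>z. P z = Q z * R z))"

end

theory Submission
  imports Defs "Jordan_Normal_Form.Schur_Decomposition"
begin

text \<open>For \<open>lam = w^n\<close> with \<open>|w|\<close> large the multipliers have moduli close to
  \<open>exp (b Re \<kappa>)\<close>, where \<open>\<kappa>\<close> runs through the \<open>n\<close>-th roots of \<open>lam\<close>. This is
  obtained without asymptotic solutions: the form \<open>\<Sum> \<plusminus>|z|^2\<close> in the modes \<open>z\<close> belonging to the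
  \<open>\<kappa>\<close>, signed according to whether \<open>Re \<kappa>\<close> exceeds \<open>c|w|\<close>, increases strictly along
  \<open>exp (- c|w|x)\<close> times any solution if no \<open>Re \<kappa>\<close> is close to \<open>c|w|\<close>, so that no multiplier has
  modulus \<open>exp (c|w|b)\<close>. On the ray \<open>lam > 0\<close> the dominant multiplier is moreover simple.

  The factors of a factorisation can be taken monic with entire coefficients. One of them, say \<open>R\<close>,
  never contains the dominant multiplier far out on the ray \<open>lam > 0\<close>. Let \<open>\<alpha>\<close> and \<open>\<beta>\<close> be
  the exponents (relative to \<open>b |lam|^(1/n)\<close>) of the largest root of \<open>R\<close> on the rays \<open>lam > 0\<close> and
  \<open>lam < 0\<close>. They are cosines of an even and an odd multiple of \<open>\<pi>/n\<close>. The
  Phragmen-Lindelof principle forces \<open>\<alpha> \<ge> \<beta> cos (\<pi>/n)\<close> and \<open>\<beta> \<ge> \<alpha> cos (\<pi>/n)\<close>, and these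
  inequalities only leave \<open>\<alpha> = 1\<close>, the dominant multiplier.\<close>

section \<open>Entire functions in sectors\<close>

text \<open>The obstacle is that the roots of a factor are in general not holomorphic in lam; only
  its coefficients are accessible to growth arguments. Bounding coefficient i by B^(d - i) and
  bounding all roots by B are equivalent up to constants, so exponential rates pass between them
  unharmed. In w, with w^n = lam, the coefficients are entire of exponential type, and the rays over
  lam > 0 and lam < 0 alternate at angle \<theta> = pi/n. Comparison with sinusoids in the argument
  of w bounds the rate on one ray by the rates on its neighbours; for the least possible rates this
  gives the two inequalities. Write \<alpha> = cos (k \<theta>) and \<beta> = cos (l \<theta>) with
  k even, l odd and 0 <= k, l <= n. If k < l, then cos (l \<theta>) <= cos ((k + 1) \<theta>) = cos
  (k \<theta>) cos \<theta> - sin (k \<theta>) sin \<theta>, which violates the second inequality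
  unless the sine vanishes, that is, k = 0. If l < k the roles are exchanged, and l is never 0.
  Hence a factor without the dominant multiplier cannot exist, and simplicity of that multiplier
  produces one.\<close>

lemma abs_Arg_le_of_wedge:
  assumes psi: "0 < \<psi>" "\<psi> < pi/2"
    and wedge: "Im (s * cis \<psi>) \<ge> 0" "Im (s * cis (-\<psi>)) \<le> 0"
  shows "\<bar>Arg s\<bar> \<le> \<psi>"
proof (cases "s = 0")
  case True
  then show ?thesis using psi by (simp add: Arg_zero)
next
  case False
  let ?a = "Arg s"
  have s: "s = of_real (norm s) * cis ?a"
    using rcis_cmod_Arg[of s] by (simp add: rcis_def)
  have bnd: "-pi < ?a" "?a \<le> pi" using Arg_bounded by auto
  have e: "Im (s * cis x) = norm s * sin (?a + x)" for x
  proof -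
    have "s * cis x = of_real (norm s) * cis (?a + x)"
      by (subst s) (simp add: cis_mult mult.assoc)
    then show ?thesis by simp
  qed
  have pos: "norm s > 0" using False by simp
  have s1: "sin (?a + \<psi>) \<ge> 0" using wedge(1) pos unfolding e by (simp add: zero_le_mult_iff)
  have s2: "sin (?a - \<psi>) \<le> 0" using wedge(2) pos unfolding e by (simp add: mult_le_0_iff)
  have "?a \<ge> - \<psi>"
  proof (rule ccontr)
    assume "\<not> ?a \<ge> - \<psi>"
    then have "sin (-(?a + \<psi>)) > 0" using bnd psi by (intro sin_gt_zero) auto
    then show False using s1 unfolding sin_minus by simp
  qed
  moreover have "?a \<le> pi - \<psi>"
  proof (rule ccontr)
    assume "\<not> ?a \<le> pi - \<psi>"
    then have "sin (?a + \<psi> - pi) > 0" using bnd psi by (intro sin_gt_zero) auto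
    then show False using s1 by (simp add: sin_diff)
  qed
  moreover have "?a \<le> \<psi>"
  proof (rule ccontr)
    assume "\<not> ?a \<le> \<psi>"
    then have "sin (?a - \<psi>) > 0" using calculation psi by (intro sin_gt_zero) auto
    then show False using s2 by simp
  qed
  ultimately show ?thesis by auto
qed

text \<open>The cube outgrows the quadratic exponent of the functions treated next, and 3 * pi/8 <
  pi/2 keeps its real part positive in the wedge, so exp (- \<eta> * s^3) can serve as a damping
  factor.\<close>

lemma Re_cube_ge_in_wedge:
  assumes "\<bar>Arg s\<bar> \<le> pi/8"
  shows "Re (s^3) \<ge> cos (3*pi/8) * norm s ^ 3"
proof -
  have s: "s = of_real (norm s) * cis (Arg s)"
    using rcis_cmod_Arg[of s] by (simp add: rcis_def)
  have "s^3 = of_real (norm s ^ 3) * cis (3 * Arg s)"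
    by (subst s) (simp add: power_mult_distrib Complex.DeMoivre)
  then have "Re (s^3) = norm s ^ 3 * cos (3 * Arg s)" by simp
  moreover have "cos (3*pi/8) \<le> cos \<bar>3 * Arg s\<bar>"
    by (subst cos_mono_le_eq) (use assms in auto)
  ultimately show ?thesis by (simp add: mult.commute mult_left_mono)
qed

text \<open>Damping by exp (- \<eta> * s^3) makes the function small on a far arc; the maximum
  principle on the truncated wedge gives a bound, and letting \<eta> tend to 0 removes the
  factor.\<close>

lemma phragmen_lindelof_wedge:
  fixes F :: "complex \<Rightarrow> complex" and D M \<psi> :: real
  assumes hol: "F holomorphic_on UNIV"
    and growth: "\<And>s. norm (F s) \<le> D * exp (D * (norm s)^2)"
    and psi: "0 < \<psi>" "\<psi> \<le> pi/8" and M: "M > 0"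
    and lower: "\<And>t. 0 \<le> t \<Longrightarrow> norm (F (of_real t * cis (-\<psi>))) \<le> M"
    and upper: "\<And>t. 0 \<le> t \<Longrightarrow> norm (F (of_real t * cis \<psi>)) \<le> M"
    and s0: "Im (s0 * cis \<psi>) \<ge> 0" "Im (s0 * cis (-\<psi>)) \<le> 0"
  shows "norm (F s0) \<le> M"
proof -
  define q where "q = cos (3*pi/8)"
  have q: "q > 0" unfolding q_def by (intro cos_gt_zero) auto
  have psi2: "\<psi> < pi/2" using psi pi_gt_zero by linarith
  have main: "norm (F s0) \<le> M * exp (\<eta> * Re (s0^3))" if eta: "\<eta> > 0" for \<eta> :: real
  proof -
    define G where "G = (\<lambda>s. F s * exp (- of_real \<eta> * s^3))"
    have holG: "G holomorphic_on UNIV" unfolding G_def by (intro holomorphic_intros hol)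
    have normG: "norm (G s) = norm (F s) * exp (- \<eta> * Re (s^3))" for s
      unfolding G_def by (simp add: norm_mult)
    have "((\<lambda>X. D * exp (D * X^2 - \<eta> * q * X^3)) \<longlongrightarrow> 0) at_top"
    proof -
      have "filterlim (\<lambda>X. D * X^2 - \<eta> * q * X^3) at_bot at_top"
      proof -
        have "filterlim (\<lambda>X. X^2 * (- D + (\<eta> * q) * X)) at_top at_top"
          using eta q
          by (intro filterlim_at_top_mult_at_top filterlim_pow_at_top filterlim_ident
               filterlim_tendsto_add_at_top[OF tendsto_const]
               filterlim_tendsto_pos_mult_at_top[OF tendsto_const]) auto
        then have "filterlim (\<lambda>X. - (D * X^2 - \<eta> * q * X^3)) at_top at_top"
          by (simp add: algebra_simps power2_eq_square power3_eq_cube)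
        then show ?thesis by (simp only: filterlim_uminus_at_bot)
      qed
      then have "((\<lambda>X. exp (D * X^2 - \<eta> * q * X^3)) \<longlongrightarrow> 0) at_top"
        by (rule filterlim_compose[OF exp_at_bot])
      from tendsto_mult_right_zero[OF this] show ?thesis .
    qed
    then have "eventually (\<lambda>X. D * exp (D * X^2 - \<eta> * q * X^3) < M) at_top"
      using M by (rule order_tendstoD)
    then have "eventually (\<lambda>X. D * exp (D * X^2 - \<eta> * q * X^3) < M \<and> X \<ge> norm s0 + 1) at_top"
      using eventually_ge_at_top by (rule eventually_conj)
    \<comment> \<open>\<open>X\<close> is so large that the arc obeys the bound M and that s0 lies
      in the truncated wedge.\<close>
    then obtain X where X: "D * exp (D * X^2 - \<eta> * q * X^3) < M" "X \<ge> norm s0 + 1"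
      using eventually_happens trivial_limit_at_top_linorder by blast
    \<comment> \<open>Half-planes describe the wedge instead of \<open>Arg\<close>, which jumps on
      the negative axis; closedness and interior then follow from continuity.\<close>
    define S where "S = {s. Im (s * cis \<psi>) \<ge> 0 \<and> Im (s * cis (-\<psi>)) \<le> 0 \<and> norm s \<le> X}"
    have closed: "closed S" unfolding S_def
      by (intro closed_Collect_conj closed_Collect_le continuous_intros)
    have "bounded S" unfolding S_def by (rule boundedI[of _ X]) auto
    have argS: "\<bar>Arg s\<bar> \<le> \<psi>" if "s \<in> S" for s
      using that psi(1) psi2 by (auto simp: S_def intro: abs_Arg_le_of_wedge)
    have le1: "norm (G s) \<le> norm (F s)" if "s \<in> S" for s
    proof -
      have "Re (s^3) \<ge> q * norm s ^3" unfolding q_def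
        using argS[OF that] psi by (intro Re_cube_ge_in_wedge) auto
      then have "Re (s^3) \<ge> 0" using q by (smt (verit) mult_nonneg_nonneg norm_ge_zero zero_le_power)
      then show ?thesis unfolding normG using eta by (intro mult_left_le) auto
    qed
    have bd: "norm (G s) \<le> M" if "s \<in> frontier S" for s
    proof -
      have sS: "s \<in> S" using that closed by (simp add: frontier_def)
      have "s \<notin> interior S" using that by (simp add: frontier_def)
      moreover have "s \<in> interior S"
        if "Im (s * cis \<psi>) > 0" "Im (s * cis (-\<psi>)) < 0" "norm s < X"
      proof (rule interiorI)
        show "open {s. Im (s * cis \<psi>) > 0 \<and> Im (s * cis (-\<psi>)) < 0 \<and> norm s < X}"
          by (intro open_Collect_conj open_Collect_less continuous_intros)
      qed (use that in \<open>auto simp: S_def\<close>)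
      ultimately consider "Im (s * cis \<psi>) = 0" | "Im (s * cis (-\<psi>)) = 0" | "norm s = X"
        using sS unfolding S_def by force
      then show ?thesis
      proof cases
        case 1
        define t where "t = Re (s * cis \<psi>)"
        have st: "s = of_real t * cis (-\<psi>)"
        proof -
          have "s * cis \<psi> = of_real t" using 1 by (simp add: complex_eq_iff t_def)
          then have "s * cis \<psi> * cis (-\<psi>) = of_real t * cis (-\<psi>)" by simp
          then show ?thesis by (simp add: mult.assoc cis_mult)
        qed
        have "s * cis (-\<psi>) = of_real t * cis (-(2*\<psi>))"
          unfolding st by (simp add: mult.assoc cis_mult)
        then have "Im (s * cis (-\<psi>)) = - t * sin (2*\<psi>)" by simp
        then have "t * sin (2*\<psi>) \<ge> 0" using sS by (simp add: S_def)
        moreover have "sin (2*\<psi>) > 0" using psi psi2 by (intro sin_gt_zero) auto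
        ultimately have "t \<ge> 0" by (simp add: zero_le_mult_iff)
        then show ?thesis using lower le1[OF sS] unfolding st by (meson order_trans)
      next
        case 2
        define t where "t = Re (s * cis (-\<psi>))"
        have st: "s = of_real t * cis \<psi>"
        proof -
          have "s * cis (-\<psi>) = of_real t" using 2 by (simp add: complex_eq_iff t_def)
          then have "s * cis (-\<psi>) * cis \<psi> = of_real t * cis \<psi>" by simp
          then show ?thesis by (simp add: mult.assoc cis_mult)
        qed
        have "s * cis \<psi> = of_real t * cis (2*\<psi>)"
          unfolding st by (simp add: mult.assoc cis_mult)
        then have "Im (s * cis \<psi>) = t * sin (2*\<psi>)" by simp
        then have "t * sin (2*\<psi>) \<ge> 0" using sS by (simp add: S_def)
        moreover have "sin (2*\<psi>) > 0" using psi psi2 by (intro sin_gt_zero) auto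
        ultimately have "t \<ge> 0" by (simp add: zero_le_mult_iff)
        then show ?thesis using upper le1[OF sS] unfolding st by (meson order_trans)
      next
        case 3
        have "Re (s^3) \<ge> q * X ^3" unfolding q_def
          using argS[OF sS] psi 3 Re_cube_ge_in_wedge[of s] by auto
        then have "- \<eta> * Re (s^3) \<le> - \<eta> * q * X^3" using eta by simp
        then have "norm (G s) \<le> D * exp (D * X^2) * exp (- \<eta> * q * X^3)"
          unfolding normG using growth[of s] 3
          by (intro mult_mono) (auto simp: order_trans[OF norm_ge_zero])
        also have "\<dots> = D * exp (D * X^2 - \<eta> * q * X^3)" by (simp add: exp_diff exp_minus field_simps)
        finally show ?thesis using X by simp
      qed
    qed
    have "norm (G s0) \<le> M"
    proof (rule maximum_modulus_frontier[of G S])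
      show "G holomorphic_on interior S" using holG by (rule holomorphic_on_subset) auto
      show "continuous_on (closure S) G" 
        using holG holomorphic_on_imp_continuous_on continuous_on_subset by blast
      show "s0 \<in> S" using s0 X by (simp add: S_def)
    qed (use bd \<open>bounded S\<close> in auto)
    then show ?thesis unfolding normG by (simp add: exp_minus field_simps)
  qed
  have "((\<lambda>\<eta>. M * exp (\<eta> * Re (s0^3))) \<longlongrightarrow> M * exp (0 * Re (s0^3))) (at_right 0)"
    by (intro tendsto_intros)
  then have "((\<lambda>\<eta>. M * exp (\<eta> * Re (s0^3))) \<longlongrightarrow> M) (at_right 0)" by simp
  then show ?thesis
    by (rule tendsto_lowerbound) (auto simp: eventually_at_filter intro!: always_eventually main)
qed

text \<open>For growth of order one and opening pi/2 the damping exponent must lie strictly between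
  1 and 2. The substitution w = s^2 * cis m turns w^(3/2) into the entire s^3 (up to a constant) and
  the sector into a wedge of half-angle at most pi/8. The sinusoid \<tau> is removed by exp (- (A -
  i B) w), whose modulus on the ray \<phi> is exactly exp (- \<tau> \<phi> |w|).\<close>

lemma phragmen_lindelof_power_sector:
  fixes f :: "complex \<Rightarrow> complex" and C M \<phi>1 \<phi>2 A B :: real
  defines "\<tau> \<equiv> \<lambda>\<phi>. A * cos \<phi> + B * sin \<phi>"
  assumes hol: "f holomorphic_on UNIV"
    and growth: "\<And>w. norm (f (w^n)) \<le> C * exp (C * norm w)"
    and phi: "\<phi>1 < \<phi>2" "\<phi>2 - \<phi>1 \<le> pi/2" and M: "M > 0"
    and ray1: "\<And>t. 0 \<le> t \<Longrightarrow> norm (f ((of_real t * cis \<phi>1)^n)) \<le> M * exp (\<tau> \<phi>1 * t)"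
    and ray2: "\<And>t. 0 \<le> t \<Longrightarrow> norm (f ((of_real t * cis \<phi>2)^n)) \<le> M * exp (\<tau> \<phi>2 * t)"
    and t: "0 \<le> t" and phi': "\<phi>1 \<le> \<phi>" "\<phi> \<le> \<phi>2"
  shows "norm (f ((of_real t * cis \<phi>)^n)) \<le> M * exp (\<tau> \<phi> * t)"
proof -
  define m where "m = (\<phi>1 + \<phi>2)/2"
  define \<psi> where "\<psi> = (\<phi>2 - \<phi>1)/4"
  define k where "k = (\<lambda>s. s^2 * cis m)"
  define F where "F = (\<lambda>s. f (k s ^ n) * exp (- (Complex A (-B) * k s)))"
  have ReAB: "Re (Complex A (-B) * (of_real r * cis x)) = \<tau> x * r" for r x
    by (simp add: \<tau>_def algebra_simps)
  have kpol: "k (of_real r * cis x) = of_real (r^2) * cis (m + 2*x)" for r x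
    by (simp add: k_def power_mult_distrib Complex.DeMoivre cis_mult mult.assoc add.commute)
  have normF: "norm (F (of_real r * cis x)) 
     = norm (f ((of_real (r^2) * cis (m + 2*x))^n)) * exp (- \<tau> (m+2*x) * r^2)" for r x
    unfolding F_def kpol norm_mult norm_exp_eq_Re using ReAB[of "r^2" "m+2*x"] by simp
  have holF: "F holomorphic_on UNIV"
  proof -
    have "f \<circ> (\<lambda>s. k s ^ n) holomorphic_on UNIV"
      by (rule holomorphic_on_compose_gen[of _ _ _ UNIV]) (auto simp: k_def intro!: holomorphic_intros hol)
    then have "(\<lambda>s. f (k s ^ n)) holomorphic_on UNIV" by (simp add: o_def)
    then show ?thesis unfolding F_def by (intro holomorphic_intros) (auto simp: k_def intro!: holomorphic_intros)
  qed
  define D where "D = \<bar>C\<bar> + norm (Complex A (-B))"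
  have growthF: "norm (F s) \<le> D * exp (D * (norm s)^2)" for s
  proof -
    have nk: "norm (k s) = norm s ^ 2" by (simp add: k_def norm_mult norm_power)
    have C0: "C \<ge> 0" using order_trans[OF norm_ge_zero growth[of 0]] by (simp add: zero_le_mult_iff)
    have "norm (F s) \<le> C * exp (C * norm s ^ 2) * exp (norm (Complex A (-B)) * norm s ^ 2)"
      unfolding F_def norm_mult norm_exp_eq_Re
    proof (intro mult_mono)
      show "norm (f (k s ^ n)) \<le> C * exp (C * norm s ^ 2)" using growth[of "k s"] by (simp add: nk)
      have "Re (- (Complex A (-B) * k s)) \<le> norm (- (Complex A (-B) * k s))" by (rule complex_Re_le_cmod)
      also have "\<dots> = norm (Complex A (-B)) * norm s ^ 2" by (simp add: norm_mult nk)
      finally show "exp (Re (- (Complex A (-B) * k s))) \<le> exp (norm (Complex A (-B)) * norm s ^ 2)" by simp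
    qed (use C0 in auto)
    also have "\<dots> = C * exp (D * norm s ^ 2)"
      using C0 by (simp add: D_def exp_add[symmetric] algebra_simps)
    also have "\<dots> \<le> D * exp (D * norm s ^ 2)" by (intro mult_right_mono) (use abs_ge_self[of C] in \<open>auto simp: D_def add_increasing2\<close>)
    finally show ?thesis .
  qed
  have psi: "0 < \<psi>" "\<psi> \<le> pi/8" using phi by (auto simp: \<psi>_def)
  define x where "x = (\<phi> - m)/2"
  have x: "\<bar>x\<bar> \<le> \<psi>" using phi' unfolding x_def \<psi>_def m_def by (auto simp: field_simps)
  have bnd: "norm (F (of_real (sqrt t) * cis x)) \<le> M"
  proof (rule phragmen_lindelof_wedge[OF holF growthF psi M])
    fix r :: real assume "0 \<le> r"
    have "m + 2 * (- \<psi>) = \<phi>1" "m + 2*\<psi> = \<phi>2" by (simp_all add: m_def \<psi>_def field_simps)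
    then show "norm (F (of_real r * cis (-\<psi>))) \<le> M" "norm (F (of_real r * cis \<psi>)) \<le> M"
      unfolding normF using ray1[of "r^2"] ray2[of "r^2"] by (simp_all add: exp_minus field_simps)
  next
    have e: "Im (of_real (sqrt t) * cis x * cis y) = sqrt t * sin (x + y)" for y
      by (simp add: mult.assoc cis_mult)
    have "sin (x + \<psi>) \<ge> 0" using x psi by (intro sin_ge_zero) auto
    then show "0 \<le> Im (of_real (sqrt t) * cis x * cis \<psi>)" unfolding e using t by simp
    have "sin (- (x - \<psi>)) \<ge> 0" using x psi by (intro sin_ge_zero) auto
    then show "Im (of_real (sqrt t) * cis x * cis (-\<psi>)) \<le> 0" unfolding e sin_minus using t by (simp add: mult_nonneg_nonpos)
  qed
  have "m + 2*x = \<phi>" by (simp add: x_def field_simps)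
  then show ?thesis using bnd t unfolding normF by (simp add: exp_minus field_simps)
qed

lemma phragmen_lindelof_midpoint:
  fixes f :: "complex \<Rightarrow> complex" and C M m \<delta> a b t :: real
  assumes hol: "f holomorphic_on UNIV"
    and growth: "\<And>w. norm (f (w^n)) \<le> C * exp (C * norm w)"
    and delta: "0 < \<delta>" "\<delta> \<le> pi/4" and M: "M > 0"
    and ray1: "\<And>t. 0 \<le> t \<Longrightarrow> norm (f ((of_real t * cis (m - \<delta>))^n)) \<le> M * exp (a * t)"
    and ray2: "\<And>t. 0 \<le> t \<Longrightarrow> norm (f ((of_real t * cis (m + \<delta>))^n)) \<le> M * exp (b * t)"
    and t: "0 \<le> t"
  shows "norm (f ((of_real t * cis m)^n)) \<le> M * exp ((a + b) / (2 * cos \<delta>) * t)"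
proof -
  \<comment> \<open>\<open>h\<close> and \<open>d\<close> are the coefficients of the sinusoid in x
    = \<phi> - m that takes the values a at -\<delta> and b at \<delta>; \<open>A\<close> and
    \<open>B\<close> rewrite it in \<phi>.\<close>
  define h where "h = (a + b) / (2 * cos \<delta>)"
  define d where "d = (b - a) / (2 * sin \<delta>)"
  have c0: "cos \<delta> > 0" using delta by (intro cos_gt_zero) auto
  have s0: "sin \<delta> > 0" using delta by (intro sin_gt_zero) auto
  define A where "A = h * cos m - d * sin m"
  define B where "B = h * sin m + d * cos m"
  have tau: "A * cos (m + x) + B * sin (m + x) = h * cos x + d * sin x" for x
  proof -
    have "A * cos (m + x) + B * sin (m + x) = (h * cos x + d * sin x) * ((sin m)\<^sup>2 + (cos m)\<^sup>2)"
      unfolding A_def B_def cos_add sin_add by (simp add: algebra_simps power2_eq_square del: sin_cos_squared_add sin_cos_squared_add2 sin_cos_squared_add3)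
    then show ?thesis by simp
  qed
  have t1: "A * cos (m - \<delta>) + B * sin (m - \<delta>) = a"
    using tau[of "-\<delta>"] c0 s0 by (simp add: h_def d_def field_simps)
  have t2: "A * cos (m + \<delta>) + B * sin (m + \<delta>) = b"
    using tau[of "\<delta>"] c0 s0 by (simp add: h_def d_def field_simps)
  have t3: "A * cos m + B * sin m = h" using tau[of 0] by simp
  have "norm (f ((of_real t * cis m)^n)) \<le> M * exp ((A * cos m + B * sin m) * t)"
    by (rule phragmen_lindelof_power_sector[OF hol growth _ _ M, of "m - \<delta>" "m + \<delta>"])
       (use ray1 ray2 t delta in \<open>auto simp: t1 t2\<close>)
  then show ?thesis unfolding t3 h_def .
qed

lemma cis_pi_div_power:
  assumes "n > 0"
  shows "cis (pi / of_nat n) ^ n = -1" 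
  using assms by (simp add: Complex.DeMoivre)

text \<open>The directions 0 and 2 * \<theta> of w both lie over lam > 0, with \<theta> (over lam <
  0) between them. One midpoint step across 2 * \<theta> would exceed the opening pi/2 for n < 4, so
  the rays at \<theta>/2 and 3 * \<theta>/2 are bounded first. The resulting exponent involves
  \<beta> itself: it is a gain exactly when \<alpha> < \<beta> cos \<theta>.\<close>

lemma kink_on_negative_ray:
  fixes f :: "complex \<Rightarrow> complex" and C M \<alpha> \<beta> :: real and n :: nat
  defines "\<theta> \<equiv> pi / real n"
  assumes n: "n \<ge> 2" and hol: "f holomorphic_on UNIV"
    and growth: "\<And>w. norm (f (w^n)) \<le> C * exp (C * norm w)" and M: "M > 0"
    and pos: "\<And>t. 0 \<le> t \<Longrightarrow> norm (f (of_real t ^ n)) \<le> M * exp (\<alpha> * t)"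
    and neg: "\<And>t. 0 \<le> t \<Longrightarrow> norm (f ((of_real t * cis \<theta>)^n)) \<le> M * exp (\<beta> * t)"
    and t: "0 \<le> t"
  shows "norm (f ((of_real t * cis \<theta>)^n)) \<le> M * exp ((\<alpha> + \<beta>) / (1 + cos \<theta>) * t)"
proof -
  have th: "0 < \<theta>/2" "\<theta>/2 \<le> pi/4" using n by (auto simp: \<theta>_def field_simps)
  have pos2: "norm (f ((of_real t * cis (2*\<theta>))^n)) \<le> M * exp (\<alpha> * t)" if "t \<ge> 0" for t
  proof -
    have "cis (2*\<theta>)^n = 1" using n by (simp add: Complex.DeMoivre \<theta>_def)
    then show ?thesis using pos[OF that] by (simp add: power_mult_distrib)
  qed
  have c0: "cos (\<theta>/2) > 0" using th by (intro cos_gt_zero) auto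
  have half1: "norm (f ((of_real t * cis (\<theta> - \<theta>/2))^n)) \<le> M * exp ((\<alpha> + \<beta>) / (2 * cos (\<theta>/2)) * t)"
    if "t \<ge> 0" for t
  proof -
    have "norm (f ((of_real t * cis (\<theta>/2))^n)) \<le> M * exp ((\<alpha> + \<beta>) / (2 * cos (\<theta>/2)) * t)"
      by (rule phragmen_lindelof_midpoint[OF hol growth th M])
         (use pos neg that in auto)
    then show ?thesis by (simp add: field_simps)
  qed
  have half2: "norm (f ((of_real t * cis (\<theta> + \<theta>/2))^n)) \<le> M * exp ((\<alpha> + \<beta>) / (2 * cos (\<theta>/2)) * t)"
    if "t \<ge> 0" for t
  proof -
    have e: "\<theta> + \<theta>/2 - \<theta>/2 = \<theta>" "\<theta> + \<theta>/2 + \<theta>/2 = 2*\<theta>" by simp_all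
    have "norm (f ((of_real t * cis (\<theta> + \<theta>/2))^n)) \<le> M * exp ((\<beta> + \<alpha>) / (2 * cos (\<theta>/2)) * t)"
      by (rule phragmen_lindelof_midpoint[OF hol growth th M])
         (use pos2 neg that in \<open>simp_all only: e\<close>)
    then show ?thesis by (simp add: add.commute)
  qed
  have "norm (f ((of_real t * cis \<theta>)^n)) \<le> M * exp (((\<alpha> + \<beta>) / (2 * cos (\<theta>/2)) + (\<alpha> + \<beta>) / (2 * cos (\<theta>/2))) / (2 * cos (\<theta>/2)) * t)"
    by (rule phragmen_lindelof_midpoint[OF hol growth th M half1 half2 t])
  also have "((\<alpha> + \<beta>) / (2 * cos (\<theta>/2)) + (\<alpha> + \<beta>) / (2 * cos (\<theta>/2))) / (2 * cos (\<theta>/2)) = (\<alpha> + \<beta>) / (2 * (cos (\<theta>/2))\<^sup>2)"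
    using c0 by (simp add: field_simps power2_eq_square)
  also have "2 * (cos (\<theta>/2))\<^sup>2 = 1 + cos \<theta>"
    using cos_double_cos[of "\<theta>/2"] by simp
  finally show ?thesis .
qed

lemma monic_poly_linear_factors:
  fixes p :: "complex poly"
  assumes "lead_coeff p = 1"
  obtains rs where "p = (\<Prod>r\<leftarrow>rs. [:- r, 1:])" "length rs = degree p" 
     "\<And>r. poly p r = 0 \<longleftrightarrow> r \<in> set rs"
proof -
  obtain rs where rs: "Polynomial.smult (lead_coeff p) (\<Prod>r\<leftarrow>rs. [:- r, 1:]) = p" "length rs = degree p"
    using fundamental_theorem_algebra_factorized by blast
  have "poly (\<Prod>r\<leftarrow>rs. [:- r, 1:]) x = 0 \<longleftrightarrow> x \<in> set rs" for x
    by (induction rs) auto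
  then show ?thesis using that[of rs] rs assms by auto
qed

lemma coeff_prod_linear_factors_le:
  fixes rs :: "complex list"
  assumes "\<And>r. r \<in> set rs \<Longrightarrow> norm r \<le> B"
  shows "i \<le> length rs \<Longrightarrow> norm (coeff (\<Prod>r\<leftarrow>rs. [:- r, 1:]) i) \<le> 2 ^ length rs * B ^ (length rs - i)"
  using assms
proof (induction rs arbitrary: i)
  case Nil
  then show ?case by simp
next
  case (Cons a rs)
  let ?p = "\<Prod>r\<leftarrow>rs. [:- r, 1:]" and ?m = "length rs"
  have B: "norm a \<le> B" "B \<ge> 0" using Cons.prems(2)[of a] order_trans[OF norm_ge_zero] by auto
  have deg: "degree ?p = ?m" by (rule degree_linear_factors)
  have lo: "norm (a * coeff ?p i) \<le> 2 ^ ?m * B ^ (Suc ?m - i)"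
  proof (cases "i \<le> ?m")
    case True
    have "norm (a * coeff ?p i) \<le> B * (2 ^ ?m * B ^ (?m - i))"
      unfolding norm_mult using B Cons.IH[OF True] Cons.prems(2) by (intro mult_mono) auto
    also have "\<dots> = 2 ^ ?m * B ^ (Suc ?m - i)" using True by (simp add: Suc_diff_le)
    finally show ?thesis .
  next
    case False
    then have "coeff ?p i = 0" by (intro coeff_eq_0) (simp add: deg)
    then show ?thesis using B by simp
  qed
  have hi: "norm (case i of 0 \<Rightarrow> 0 | Suc j \<Rightarrow> coeff ?p j) \<le> 2 ^ ?m * B ^ (Suc ?m - i)"
  proof (cases i)
    case (Suc j)
    then show ?thesis using Cons.IH[of j] Cons.prems by simp
  qed (use B in simp)
  have "coeff (\<Prod>r\<leftarrow>(a#rs). [:- r, 1:]) i = (case i of 0 \<Rightarrow> 0 | Suc j \<Rightarrow> coeff ?p j) - a * coeff ?p i"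
    by (cases i) simp_all
  then have "norm (coeff (\<Prod>r\<leftarrow>(a#rs). [:- r, 1:]) i) \<le> norm (case i of 0 \<Rightarrow> 0 | Suc j \<Rightarrow> coeff ?p j) + norm (a * coeff ?p i)"
    by (metis norm_triangle_ineq4)
  also have "\<dots> \<le> 2 ^ ?m * B ^ (Suc ?m - i) + 2 ^ ?m * B ^ (Suc ?m - i)"
    by (rule add_mono[OF hi lo])
  finally show ?case by simp
qed

text \<open>The weight B^(degree p - i) matches the homogeneity of the coefficients in the roots, so
  this bound and its converse below lose constants but no exponential rate.\<close>

lemma coeff_le_of_roots_le:
  fixes p :: "complex poly"
  assumes "lead_coeff p = 1" "\<And>r. poly p r = 0 \<Longrightarrow> norm r \<le> B" "i \<le> degree p"
  shows "norm (coeff p i) \<le> 2 ^ degree p * B ^ (degree p - i)"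
  using monic_poly_linear_factors[OF assms(1)] coeff_prod_linear_factors_le assms(2,3) by metis

text \<open>For |r| > B the lower terms add up to at most degree p * D * B / |r| times the leading
  one.\<close>

lemma root_le_of_coeffs_le:
  fixes p :: "complex poly"
  assumes lead: "lead_coeff p = 1" and B: "B > 0" and D: "D \<ge> 0"
    and coeffs: "\<And>i. i < degree p \<Longrightarrow> norm (coeff p i) \<le> D * B ^ (degree p - i)"
    and root: "poly p r = 0"
  shows "norm r \<le> (1 + real (degree p) * D) * B"
proof (rule ccontr)
  let ?m = "degree p"
  assume "\<not> norm r \<le> (1 + real ?m * D) * B"
  then have r: "norm r > B + real ?m * D * B" by (simp add: algebra_simps)
  have "real ?m * D * B \<ge> 0" using B D by simp
  then have rB: "norm r > B" using r by linarith
  then have r0: "norm r > 0" using B by linarith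
  have m: "?m > 0"
  proof (rule ccontr)
    assume "\<not> ?m > 0"
    then obtain c where "p = [:c:]" by (auto elim: degree_eq_zeroE)
    then show False using lead root by auto
  qed
  have "r ^ ?m = - (\<Sum>i<?m. coeff p i * r ^ i)"
    using root lead unfolding poly_altdef by (simp add: lessThan_Suc_atMost[symmetric] add_eq_0_iff)
  then have "norm r ^ ?m = norm (\<Sum>i<?m. coeff p i * r ^ i)" by (metis norm_minus_cancel norm_power)
  also have "\<dots> \<le> (\<Sum>i<?m. norm (coeff p i * r ^ i))" by (rule norm_sum)
  also have "\<dots> \<le> (\<Sum>i<?m. D * B * norm r ^ (?m - 1))"
  proof (rule sum_mono)
    fix i assume i: "i \<in> {..<?m}"
    have "norm (coeff p i * r ^ i) \<le> D * B ^ (?m - i) * norm r ^ i"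
      unfolding norm_mult norm_power using coeffs i by (intro mult_right_mono) auto
    also have "B ^ (?m - i) = B * B ^ (?m - 1 - i)" using i by (simp add: Suc_diff_Suc flip: power_Suc)
    also have "D * (B * B ^ (?m - 1 - i)) * norm r ^ i \<le> D * (B * norm r ^ (?m - 1 - i)) * norm r ^ i"
      using B D rB by (intro mult_right_mono mult_left_mono power_mono) auto
    also have "\<dots> = D * B * norm r ^ (?m - 1)" using i by (simp flip: power_add)
    finally show "norm (coeff p i * r ^ i) \<le> D * B * norm r ^ (?m - 1)" .
  qed
  also have "\<dots> = real ?m * D * B * norm r ^ (?m - 1)" by simp
  finally have "norm r * norm r ^ (?m - 1) \<le> real ?m * D * B * norm r ^ (?m - 1)"
    using m by (simp flip: power_Suc)
  then have "norm r \<le> real ?m * D * B" using r0 by simp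
  then show False using r B by linarith
qed

section \<open>Linear systems depending on a parameter\<close>

text \<open>Companion form, with \<open>y i\<close> in the role of the i-th derivative. The forcing
  \<open>f\<close> is there because the difference of solutions for two parameters solves such a
  system, with a multiple of one of them as \<open>f\<close>.\<close>

definition forced_system ::
  "nat \<Rightarrow> (nat \<Rightarrow> real \<Rightarrow> complex) \<Rightarrow> complex \<Rightarrow> (real \<Rightarrow> complex) \<Rightarrow> (nat \<Rightarrow> real \<Rightarrow> complex) \<Rightarrow> bool" where
  "forced_system n p lam f y \<longleftrightarrow> (\<forall>i<n. \<forall>x. (y i has_vector_derivative
     (if Suc i = n then lam * y 0 x - (\<Sum>k\<le>n-2. p k x * y k x) + f x else y (Suc i) x)) (at x))"

lemma forced_systemI:
  assumes "\<And>i x. i < n \<Longrightarrow> Suc i \<noteq> n \<Longrightarrow> (y i has_vector_derivative y (Suc i) x) (at x)"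
    and "\<And>i x. Suc i = n \<Longrightarrow> (y i has_vector_derivative 
           (lam * y 0 x - (\<Sum>k\<le>n-2. p k x * y k x) + f x)) (at x)"
  shows "forced_system n p lam f y"
  using assms unfolding forced_system_def by auto

lemma forced_systemD:
  assumes "forced_system n p lam f y"
  shows "i < n \<Longrightarrow> Suc i \<noteq> n \<Longrightarrow> (y i has_vector_derivative y (Suc i) x) (at x)"
    and "Suc i = n \<Longrightarrow> (y i has_vector_derivative 
           (lam * y 0 x - (\<Sum>k\<le>n-2. p k x * y k x) + f x)) (at x)"
  using assms unfolding forced_system_def by auto

lemma forced_system_diff:
  assumes "forced_system n p lam f y" "forced_system n p lam g z"
  shows "forced_system n p lam (\<lambda>x. f x - g x) (\<lambda>i x. y i x - z i x)"
proof (rule forced_systemI)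
  fix i x assume "i < n" "Suc i \<noteq> n"
  then show "((\<lambda>x. y i x - z i x) has_vector_derivative y (Suc i) x - z (Suc i) x) (at x)"
    by (intro has_vector_derivative_diff forced_systemD(1)[OF assms(1)] forced_systemD(1)[OF assms(2)])
next
  fix i x assume "Suc i = n"
  from has_vector_derivative_diff[OF forced_systemD(2)[OF assms(1) this] forced_systemD(2)[OF assms(2) this]]
  show "((\<lambda>x. y i x - z i x) has_vector_derivative lam * (y 0 x - z 0 x) -
          (\<Sum>k\<le>n - 2. p k x * (y k x - z k x)) + (f x - g x)) (at x)"
    by (simp add: algebra_simps sum_subtractf)
qed

lemma forced_system_cmult:
  assumes "forced_system n p lam f y"
  shows "forced_system n p lam (\<lambda>x. c * f x) (\<lambda>i x. c * y i x)"
proof (rule forced_systemI)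
  fix i x assume "i < n" "Suc i \<noteq> n"
  then show "((\<lambda>x. c * y i x) has_vector_derivative c * y (Suc i) x) (at x)"
    by (intro has_vector_derivative_mult_right forced_systemD(1)[OF assms(1)])
next
  fix i x assume "Suc i = n"
  from has_vector_derivative_mult_right[OF forced_systemD(2)[OF assms(1) this]]
  have "((\<lambda>x. c * y i x) has_vector_derivative c * (lam * y 0 x - (\<Sum>k\<le>n - 2. p k x * y k x) + f x)) (at x)" .
  also have "c * (lam * y 0 x - (\<Sum>k\<le>n - 2. p k x * y k x) + f x) = lam * (c * y 0 x) - (\<Sum>k\<le>n - 2. p k x * (c * y k x)) + c * f x"
    by (simp add: algebra_simps sum_distrib_left)
  finally show "((\<lambda>x. c * y i x) has_vector_derivative lam * (c * y 0 x) - (\<Sum>k\<le>n - 2. p k x * (c * y k x)) + c * f x) (at x)" .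
qed

lemma forced_system_sum:
  assumes "finite J" "\<And>j. j \<in> J \<Longrightarrow> forced_system n p lam (\<lambda>_. 0) (y j)"
  shows "forced_system n p lam (\<lambda>_. 0) (\<lambda>i x. \<Sum>j\<in>J. c j * y j i x)"
proof (rule forced_systemI)
  fix i x assume "i < n" "Suc i \<noteq> n"
  then show "((\<lambda>x. \<Sum>j\<in>J. c j * y j i x) has_vector_derivative (\<Sum>j\<in>J. c j * y j (Suc i) x)) (at x)"
    using assms by (intro has_vector_derivative_sum has_vector_derivative_mult_right forced_systemD(1)) auto
next
  fix i x assume i: "Suc i = n"
  have "((\<lambda>x. \<Sum>j\<in>J. c j * y j i x) has_vector_derivative 
      (\<Sum>j\<in>J. c j * (lam * y j 0 x - (\<Sum>k\<le>n-2. p k x * y j k x) + 0))) (at x)"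
    using assms i by (intro has_vector_derivative_sum has_vector_derivative_mult_right forced_systemD(2)) auto
  also have "(\<Sum>j\<in>J. c j * (lam * y j 0 x - (\<Sum>k\<le>n-2. p k x * y j k x) + 0))
    = (\<Sum>j\<in>J. lam * (c j * y j 0 x) - (\<Sum>k\<le>n-2. p k x * (c j * y j k x)))"
    by (intro sum.cong refl) (simp add: algebra_simps sum_distrib_left)
  also have "\<dots> = lam * (\<Sum>j\<in>J. c j * y j 0 x) - (\<Sum>k\<le>n - 2. p k x * (\<Sum>j\<in>J. c j * y j k x)) + 0"
    by (subst (2) sum_distrib_left) (simp add: sum_subtractf sum_distrib_left sum.swap[of _ J "{..n-2}"])
  finally show "((\<lambda>x. \<Sum>j\<in>J. c j * y j i x) has_vector_derivative lam * (\<Sum>j\<in>J. c j * y j 0 x) -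
          (\<Sum>k\<le>n - 2. p k x * (\<Sum>j\<in>J. c j * y j k x)) + 0) (at x)" .
qed

lemma norm_power2_has_real_derivative:
  fixes f :: "real \<Rightarrow> complex"
  assumes "(f has_vector_derivative f') (at x)"
  shows "((\<lambda>x. (norm (f x))\<^sup>2) has_real_derivative 2 * Re (cnj (f x) * f')) (at x)"
proof -
  have "((\<lambda>x. inner (f x) (f x)) has_vector_derivative (inner (f x) f' + inner f' (f x))) (at x)"
    by (rule bounded_bilinear.has_vector_derivative[OF bounded_bilinear_inner assms assms])
  then show ?thesis
    by (simp add: has_real_derivative_iff_has_vector_derivative power2_norm_eq_inner inner_complex_def algebra_simps)
qed

text \<open>Squared norms are differentiable where norms need not be. Carrying \<delta>^2 along
  makes the differential inequality homogeneous: in the rate, 2 * K * n pays for the linear terms, n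
  for the forcing in n components, and 1 for the squares split off by 2 * \<delta> * |y| <=
  \<delta>^2 + |y|^2.\<close>

lemma gronwall_squared:
  fixes y d :: "nat \<Rightarrow> real \<Rightarrow> complex" and K \<delta> b :: real
  assumes der: "\<And>i x. i < n \<Longrightarrow> 0 \<le> x \<Longrightarrow> x \<le> b \<Longrightarrow> (y i has_vector_derivative d i x) (at x)"
    and le: "\<And>i x. i < n \<Longrightarrow> 0 \<le> x \<Longrightarrow> x \<le> b \<Longrightarrow> norm (d i x) \<le> K * (\<Sum>j<n. norm (y j x)) + \<delta>"
    and K: "K \<ge> 0" and \<delta>: "\<delta> \<ge> 0" and x: "0 \<le> x" "x \<le> b"
  shows "(\<Sum>i<n. (norm (y i x))\<^sup>2) + \<delta>\<^sup>2 
     \<le> ((\<Sum>i<n. (norm (y i 0))\<^sup>2) + \<delta>\<^sup>2) * exp ((2*K*n + n + 1) * x)"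
proof -
  define L where "L = 2*K*n + n + 1"
  define N where "N = (\<lambda>x. \<Sum>i<n. (norm (y i x))\<^sup>2)"
  define U where "U = (\<lambda>x. (N x + \<delta>\<^sup>2) * exp (- L * x))"
  have "U x \<le> U 0"
  proof (rule DERIV_nonpos_imp_nonincreasing[OF x(1)])
    fix t assume t: "0 \<le> t" "t \<le> x"
    define N' where "N' = (\<Sum>i<n. 2 * Re (cnj (y i t) * d i t))"
    define S where "S = (\<Sum>j<n. norm (y j t))"
    have S0: "S \<ge> 0" unfolding S_def by (intro sum_nonneg) auto
    have N0: "N t \<ge> 0" unfolding N_def by (intro sum_nonneg) auto
    have dN: "(N has_real_derivative N') (at t)"
      unfolding N_def N'_def using t x der
      by (intro DERIV_sum norm_power2_has_real_derivative) auto
    have dU: "(U has_real_derivative (N' - L * (N t + \<delta>\<^sup>2)) * exp (- L * t)) (at t)"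
      unfolding U_def by (rule derivative_eq_intros dN refl)+ (simp add: algebra_simps)
    have S2: "S\<^sup>2 \<le> N t * n"
      unfolding S_def N_def using sum_squared_le_sum_of_squares[of "\<lambda>j. norm (y j t)" "{..<n}"] by simp
    have "N' \<le> (\<Sum>i<n. 2 * K * S * norm (y i t) + (\<delta>\<^sup>2 + (norm (y i t))\<^sup>2))"
      unfolding N'_def
    proof (rule sum_mono)
      fix i assume i: "i \<in> {..<n}"
      have "Re (cnj (y i t) * d i t) \<le> norm (cnj (y i t) * d i t)" by (rule complex_Re_le_cmod)
      also have "\<dots> = norm (y i t) * norm (d i t)" by (simp add: norm_mult)
      also have "\<dots> \<le> norm (y i t) * (K * S + \<delta>)"
        unfolding S_def using le[of i t] i t x by (intro mult_left_mono) auto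
      finally have "2 * Re (cnj (y i t) * d i t) \<le> 2 * K * S * norm (y i t) + 2 * (\<delta> * norm (y i t))"
        by (simp add: algebra_simps)
      also have "2 * (\<delta> * norm (y i t)) \<le> \<delta>\<^sup>2 + (norm (y i t))\<^sup>2"
        using sum_squares_bound[of \<delta> "norm (y i t)"] by simp
      finally show "2 * Re (cnj (y i t) * d i t) \<le> 2 * K * S * norm (y i t) + (\<delta>\<^sup>2 + (norm (y i t))\<^sup>2)" by simp
    qed
    also have "\<dots> = 2 * K * S\<^sup>2 + (n * \<delta>\<^sup>2 + N t)"
      by (simp add: sum.distrib N_def S_def power2_eq_square flip: sum_distrib_left)
    also have "\<dots> \<le> 2 * K * (N t * n) + (n * \<delta>\<^sup>2 + N t)"
      using S2 K by (intro add_right_mono mult_left_mono) auto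
    also have "\<dots> \<le> L * (N t + \<delta>\<^sup>2)"
    proof -
      have "L * (N t + \<delta>\<^sup>2) - (2 * K * (N t * n) + (n * \<delta>\<^sup>2 + N t)) = n * N t + (2*K*n + 1) * \<delta>\<^sup>2"
        unfolding L_def by (simp add: algebra_simps)
      moreover have "\<dots> \<ge> 0" using N0 K by (intro add_nonneg_nonneg mult_nonneg_nonneg) auto
      ultimately show ?thesis by linarith
    qed
    finally have "(N' - L * (N t + \<delta>\<^sup>2)) * exp (- L * t) \<le> 0" by (intro mult_nonpos_nonneg) auto
    with dU show "\<exists>y. (U has_real_derivative y) (at t) \<and> y \<le> 0" by blast
  qed
  then have "N x + \<delta>\<^sup>2 \<le> (N 0 + \<delta>\<^sup>2) * exp (L * x)"
    unfolding U_def by (simp add: exp_minus field_simps)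
  then show ?thesis unfolding N_def L_def .
qed

text \<open>The constant depends on lam only through \<Lambda>, hence is uniform on discs, and for
  zero initial values the bound on |y| is proportional to \<delta>. In \<Lambda> + B + 1 the
  summands belong to lam, to the coefficients and to the shift to the next derivative.\<close>

lemma forced_system_bound:
  fixes y p :: "nat \<Rightarrow> real \<Rightarrow> complex" and B \<Lambda> \<delta> b :: real and n :: nat
  defines "L \<equiv> 2*(\<Lambda> + B + 1)*n + n + 1"
  assumes sys: "forced_system n p lam f y" and n: "n \<ge> 2" and b: "b > 0"
    and B: "\<And>k x. k \<le> n-2 \<Longrightarrow> 0 \<le> x \<Longrightarrow> x \<le> b \<Longrightarrow> norm (p k x) \<le> B" "B \<ge> 0"
    and lam: "norm lam \<le> \<Lambda>"
    and f: "\<And>x. 0 \<le> x \<Longrightarrow> x \<le> b \<Longrightarrow> norm (f x) \<le> \<delta>"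
    and x: "0 \<le> x" "x \<le> b" and i: "i < n"
  shows "(norm (y i x))\<^sup>2 \<le> ((\<Sum>i<n. (norm (y i 0))\<^sup>2) + \<delta>\<^sup>2) * exp (L * b)"
proof -
  have \<delta>: "\<delta> \<ge> 0" using f[of 0] b order_trans[OF norm_ge_zero] by force
  have \<Lambda>: "\<Lambda> \<ge> 0" using lam order_trans[OF norm_ge_zero] by blast
  let ?S = "\<lambda>x. \<Sum>j<n. norm (y j x)"
  have S1: "norm (y j x) \<le> ?S x" if "j < n" for j x
    using member_le_sum[of j "{..<n}" "\<lambda>j. norm (y j x)"] that by simp
  have "(\<Sum>i<n. (norm (y i x))\<^sup>2) + \<delta>\<^sup>2 
     \<le> ((\<Sum>i<n. (norm (y i 0))\<^sup>2) + \<delta>\<^sup>2) * exp ((2*(\<Lambda>+B+1)*n + n + 1) * x)"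
  proof (rule gronwall_squared[OF _ _ _ \<delta> x])
    show "(y i has_vector_derivative (if Suc i = n then lam * y 0 x - (\<Sum>k\<le>n-2. p k x * y k x) + f x else y (Suc i) x)) (at x)"
      if "i < n" "0 \<le> x" "x \<le> b" for i x using sys that unfolding forced_system_def by blast
    show "\<Lambda>+B+1 \<ge> 0" using \<Lambda> B by simp
    fix i x assume i: "i < n" "0 \<le> x" "x \<le> b"
    have S0: "?S x \<ge> 0" by (intro sum_nonneg) auto
    show "norm (if Suc i = n then lam * y 0 x - (\<Sum>k\<le>n-2. p k x * y k x) + f x else y (Suc i) x)
         \<le> (\<Lambda>+B+1) * ?S x + \<delta>"
    proof (cases "Suc i = n")
      case True
      have "norm (\<Sum>k\<le>n-2. p k x * y k x) \<le> (\<Sum>k\<le>n-2. B * norm (y k x))"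
        using B i by (intro sum_norm_le) (auto simp: norm_mult intro!: mult_right_mono)
      also have "\<dots> \<le> B * ?S x"
        unfolding sum_distrib_left[symmetric] using B n by (intro mult_left_mono sum_mono2) auto
      finally have s: "norm (\<Sum>k\<le>n-2. p k x * y k x) \<le> B * ?S x" .
      have l: "norm (lam * y 0 x) \<le> \<Lambda> * ?S x"
        unfolding norm_mult using lam \<Lambda> S1[of 0 x] n by (intro mult_mono) auto
      have "norm (lam * y 0 x - (\<Sum>k\<le>n-2. p k x * y k x) + f x) 
         \<le> norm (lam * y 0 x) + norm (\<Sum>k\<le>n-2. p k x * y k x) + norm (f x)"
        by (meson norm_triangle_ineq norm_triangle_ineq4 order_trans add_right_mono)
      also have "\<dots> \<le> \<Lambda> * ?S x + B * ?S x + \<delta>" using s l f i by (intro add_mono) auto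
      also have "\<dots> \<le> (\<Lambda>+B+1) * ?S x + \<delta>" using S0 by (simp add: algebra_simps)
      finally show ?thesis using True by simp
    next
      case False
      have "norm (y (Suc i) x) \<le> 1 * ?S x" using S1[of "Suc i" x] False i by simp
      also have "\<dots> \<le> (\<Lambda>+B+1) * ?S x" using S0 \<Lambda> B by (intro mult_right_mono) auto
      finally show ?thesis using False \<delta> by simp
    qed
  qed
  also have "\<dots> \<le> ((\<Sum>i<n. (norm (y i 0))\<^sup>2) + \<delta>\<^sup>2) * exp (L * b)"
    unfolding L_def using x \<Lambda> B
    by (intro mult_left_mono add_nonneg_nonneg sum_nonneg) (auto intro!: mult_left_mono)
  finally have "(\<Sum>i<n. (norm (y i x))\<^sup>2) + \<delta>\<^sup>2 \<le> ((\<Sum>i<n. (norm (y i 0))\<^sup>2) + \<delta>\<^sup>2) * exp (L * b)" .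
  moreover have "(norm (y i x))\<^sup>2 \<le> (\<Sum>i<n. (norm (y i x))\<^sup>2)"
    using member_le_sum[of i "{..<n}" "\<lambda>j. (norm (y j x))\<^sup>2"] i by simp
  ultimately show ?thesis by (smt (verit) zero_le_power2)
qed

section \<open>Analytic dependence on the parameter\<close>

lemma field_differentiable_of_lipschitz_quotient:
  fixes f :: "complex \<Rightarrow> complex"
  defines "q \<equiv> \<lambda>z w. (f w - f z) / (w - z)"
  assumes lip: "\<And>w w'. w \<in> ball z 1 - {z} \<Longrightarrow> w' \<in> ball z 1 - {z} \<Longrightarrow> norm (q z w - q z w') \<le> C * norm (w - w')"
  shows "f field_differentiable at z"
proof -
  let ?X = "ball z 1 - {z}"
  have "uniformly_continuous_on ?X (q z)"
    unfolding uniformly_continuous_on_def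
  proof (intro allI impI)
    fix e :: real assume e: "e > 0"
    have "dist (q z w') (q z w) < e" if "w \<in> ?X" "w' \<in> ?X" "dist w' w < e / (\<bar>C\<bar> + 1)" for w w'
    proof -
      have "norm (q z w' - q z w) \<le> C * norm (w' - w)" using lip that by blast
      also have "\<dots> \<le> \<bar>C\<bar> * norm (w' - w)" by (intro mult_right_mono) auto
      also have "\<dots> \<le> (\<bar>C\<bar> + 1) * norm (w' - w)" by (intro mult_right_mono) auto
      also have "\<dots> < e" using that(3) by (simp add: dist_norm field_simps)
      finally show ?thesis by (simp add: dist_norm)
    qed
    then show "\<exists>d>0. \<forall>w\<in>?X. \<forall>w'\<in>?X. dist w' w < d \<longrightarrow> dist (q z w') (q z w) < e"
      using e by (intro exI[of _ "e / (\<bar>C\<bar> + 1)"]) auto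
  qed
  moreover have "z \<in> closure ?X"
    using islimpt_ball[of z z 1] by (simp add: closure_def islimpt_punctured[symmetric])
  ultimately obtain l where l: "(q z \<longlongrightarrow> l) (at z within ?X)"
    by (rule uniformly_continuous_on_extension_at_closure)
  have "at z within ?X = at z within ball z 1" by (simp add: at_within_def)
  also have "\<dots> = at z" by (rule at_within_open) auto
  finally have "at z within ?X = at z" .
  then have "(f has_field_derivative l) (at z)"
    using l unfolding has_field_derivative_iff q_def by simp
  then show ?thesis by (auto simp: field_differentiable_def)
qed

text \<open>Difference quotients in the parameter solve a forced system themselves, so Gronwall's
  inequality makes them Lipschitz; their limit exists by completeness, without recourse to an
  existence theorem for the variational equation.\<close>

theorem fundamental_solutions_entire:
  fixes p :: "nat \<Rightarrow> real \<Rightarrow> complex" and Y :: "complex \<Rightarrow> nat \<Rightarrow> real \<Rightarrow> complex" and b B :: real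
  assumes n: "n \<ge> 2" and b: "b > 0"
    and B: "\<And>k x. k \<le> n-2 \<Longrightarrow> 0 \<le> x \<Longrightarrow> x \<le> b \<Longrightarrow> norm (p k x) \<le> B" "B \<ge> 0"
    and sys: "\<And>\<mu>. forced_system n p \<mu> (\<lambda>_. 0) (Y \<mu>)"
    and init: "\<And>\<mu> i. i < n \<Longrightarrow> Y \<mu> i 0 = v i"
    and i: "i < n"
  shows "(\<lambda>\<mu>. Y \<mu> i b) holomorphic_on UNIV"
proof -
  have "(\<lambda>\<mu>. Y \<mu> i b) field_differentiable at lam" for lam
  proof -
    define \<Lambda> where "\<Lambda> = norm lam + 1"
    define E where "E = exp ((2*(\<Lambda> + B + 1)*n + n + 1) * b)"
    define G where "G = sqrt E"
    have E: "E > 0" unfolding E_def by simp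
    have G: "G > 0" "G\<^sup>2 = E" unfolding G_def using E by auto
    have nlam: "norm \<mu> \<le> \<Lambda>" if "\<mu> \<in> ball lam 1" for \<mu>
      using that norm_triangle_ineq2[of \<mu> lam] unfolding \<Lambda>_def by (simp add: dist_norm norm_minus_commute)
    have zero_init: "norm (y i x) \<le> G * \<delta>" 
      if "forced_system n p \<mu> f y" "\<mu> \<in> ball lam 1" "\<And>x. 0 \<le> x \<Longrightarrow> x \<le> b \<Longrightarrow> norm (f x) \<le> \<delta>"
        "\<And>i. i < n \<Longrightarrow> y i 0 = 0" "0 \<le> x" "x \<le> b" "i < n" for \<mu> f y \<delta> i x
    proof -
      have \<delta>: "\<delta> \<ge> 0" using that(3)[of 0] b order_trans[OF norm_ge_zero] by force
      have "(norm (y i x))\<^sup>2 \<le> ((\<Sum>i<n. (norm (y i 0))\<^sup>2) + \<delta>\<^sup>2) * E"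
        unfolding E_def by (rule forced_system_bound[OF that(1) n b B nlam[OF that(2)] that(3) that(5-7)])
      also have "\<dots> = (G * \<delta>)\<^sup>2" using that(4) G(2) by (simp add: power_mult_distrib)
      finally show ?thesis by (rule power2_le_imp_le) (use G(1) \<delta> in simp)
    qed
    define N where "N = sqrt (\<Sum>i<n. (norm (v i))\<^sup>2)"
    have N: "N \<ge> 0" "N\<^sup>2 = (\<Sum>i<n. (norm (v i))\<^sup>2)" unfolding N_def by (simp_all add: sum_nonneg)
    have bound: "norm (Y \<mu> i x) \<le> N * G" if "\<mu> \<in> ball lam 1" "0 \<le> x" "x \<le> b" "i < n" for \<mu> i x
    proof -
      have "(norm (Y \<mu> i x))\<^sup>2 \<le> ((\<Sum>i<n. (norm (Y \<mu> i 0))\<^sup>2) + 0\<^sup>2) * E"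
        unfolding E_def by (rule forced_system_bound[OF sys n b B nlam[OF that(1)] _ that(2-4)]) simp_all
      also have "\<dots> = (N * G)\<^sup>2" using G(2) N(2) init by (simp add: power_mult_distrib)
      finally show ?thesis by (rule power2_le_imp_le) (use G(1) N in simp)
    qed
    \<comment> \<open>Writing \<nu> * Y \<nu> as \<mu> * Y \<nu> + (\<nu> - \<mu>) * Y \<nu> puts
      both solutions over the parameter \<mu>.\<close>
    have diff_sys: "forced_system n p \<mu> (\<lambda>x. (\<mu> - \<nu>) * Y \<nu> 0 x) (\<lambda>i x. Y \<mu> i x - Y \<nu> i x)" for \<mu> \<nu>
    proof -
      have "forced_system n p \<mu> (\<lambda>x. (\<nu> - \<mu>) * Y \<nu> 0 x) (Y \<nu>)"
        using forced_systemD[OF sys[of \<nu>]] by (intro forced_systemI) (auto simp: algebra_simps)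
      from forced_system_diff[OF sys[of \<mu>] this]
      have "forced_system n p \<mu> (\<lambda>x. 0 - (\<nu> - \<mu>) * Y \<nu> 0 x) (\<lambda>i x. Y \<mu> i x - Y \<nu> i x)" .
      also have "(\<lambda>x. 0 - (\<nu> - \<mu>) * Y \<nu> 0 x) = (\<lambda>x. (\<mu> - \<nu>) * Y \<nu> 0 x)"
        by (simp add: algebra_simps)
      finally show ?thesis .
    qed
    have lip: "norm (Y \<mu> i x - Y \<nu> i x) \<le> G * (norm (\<mu> - \<nu>) * (N * G))"
      if "\<mu> \<in> ball lam 1" "\<nu> \<in> ball lam 1" "0 \<le> x" "x \<le> b" "i < n" for \<mu> \<nu> i x
      by (rule zero_init[OF diff_sys that(1) _ _ that(3-5)])
         (use bound that n init in \<open>auto simp: norm_mult intro!: mult_left_mono\<close>)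
    define D where "D = (\<lambda>\<mu> i x. (Y \<mu> i x - Y lam i x) / (\<mu> - lam))"
    \<comment> \<open>Here \<open>diff_sys\<close> is used with lam as the common parameter, so
      quotients for different \<mu> solve the same system and can be subtracted; in exchange the
      forcing is Y \<mu> instead of Y lam.\<close>
    have D_sys: "forced_system n p lam (\<lambda>x. Y \<mu> 0 x) (D \<mu>)" if "\<mu> \<noteq> lam" for \<mu>
    proof -
      have "forced_system n p lam (\<lambda>x. (-1/(\<mu>-lam)) * ((lam - \<mu>) * Y \<mu> 0 x)) (\<lambda>i x. (-1/(\<mu>-lam)) * (Y lam i x - Y \<mu> i x))"
        by (rule forced_system_cmult[OF diff_sys])
      moreover have "(\<lambda>x. (-1/(\<mu>-lam)) * ((lam - \<mu>) * Y \<mu> 0 x)) = (\<lambda>x. Y \<mu> 0 x)"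
        using that by (simp add: fun_eq_iff divide_simps) (simp add: algebra_simps)
      moreover have "(\<lambda>i x. (-1/(\<mu>-lam)) * (Y lam i x - Y \<mu> i x)) = D \<mu>"
        using that by (simp add: fun_eq_iff divide_simps D_def)
      ultimately show ?thesis by simp
    qed
    \<comment> \<open>Initial values do not depend on the parameter, so all quotients vanish at 0;
      their difference is forced by Y \<mu> - Y \<nu>, which \<open>lip\<close> controls.\<close>
    have "norm (D \<mu> i b - D \<nu> i b) \<le> G * (G * (norm (\<mu> - \<nu>) * (N * G)))"
      if "\<mu> \<in> ball lam 1 - {lam}" "\<nu> \<in> ball lam 1 - {lam}" for \<mu> \<nu>
    proof (rule zero_init[OF forced_system_diff[OF D_sys D_sys]])
      show "norm (Y \<mu> 0 x - Y \<nu> 0 x) \<le> G * (norm (\<mu> - \<nu>) * (N * G))" if "0 \<le> x" "x \<le> b" for x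
        using lip that \<open>\<mu> \<in> _\<close> \<open>\<nu> \<in> _\<close> n by simp
    qed (use that b i init in \<open>auto simp: D_def\<close>)
    then show ?thesis
      by (intro field_differentiable_of_lipschitz_quotient[where C = "G * (G * (N * G))"])
         (auto simp: D_def algebra_simps)
  qed
  then show ?thesis by (simp add: holomorphic_on_def field_differentiable_at_within)
qed

section \<open>Modes of the leading part and the indefinite form\<close>

definition char_exponent :: "nat \<Rightarrow> complex \<Rightarrow> nat \<Rightarrow> complex" where
  "char_exponent n w j = w * cis (2 * pi * real j / real n)"

text \<open>Pairing with a left eigenvector of the companion matrix of u^(n) = w^n u. Without lower
  order terms each mode would satisfy z' = \<kappa> z.\<close>

definition mode :: "nat \<Rightarrow> complex \<Rightarrow> nat \<Rightarrow> (nat \<Rightarrow> complex) \<Rightarrow> complex" where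
  "mode n w j v = (\<Sum>i<n. char_exponent n w j ^ (n - 1 - i) * v i)"

definition indef_form :: "nat \<Rightarrow> complex \<Rightarrow> real \<Rightarrow> (nat \<Rightarrow> complex) \<Rightarrow> real" where
  "indef_form n w c v = (\<Sum>j<n. sgn (Re (char_exponent n w j) - c * norm w) * (norm (mode n w j v))\<^sup>2)"

lemma norm_char_exponent [simp]: "norm (char_exponent n w j) = norm w"
  by (simp add: char_exponent_def norm_mult)

lemma char_exponent_power: "n > 0 \<Longrightarrow> char_exponent n w j ^ n = w ^ n"
  by (simp add: char_exponent_def power_mult_distrib Complex.DeMoivre)

text \<open>n is the only multiple of n in this range, and the range contains the exponents m + n -
  i with i, m < n that arise when the modes are inverted.\<close>

lemma sum_cis_roots_of_unity:
  assumes q: "0 < q" "q < 2 * n"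
  shows "(\<Sum>j<n. cis (2 * pi * real j / real n) ^ q) = (if q = n then of_nat n else 0)"
proof -
  define z where "z = cis (2 * pi * real q / real n)"
  have n: "n > 0" using q by simp
  have e: "cis (2 * pi * real j / real n) ^ q = z ^ j" for j
    by (simp add: z_def Complex.DeMoivre mult_ac)
  have zn: "z ^ n = 1"
    using n by (simp add: z_def Complex.DeMoivre)
  have z1: "z = 1 \<longleftrightarrow> n dvd q"
  proof -
    have "z = exp (2 * of_real pi * \<i> * of_nat q / of_nat n)"
      unfolding z_def cis_conv_exp by (simp add: mult_ac)
    then show ?thesis using complex_root_unity_eq_1[of n q] n by simp
  qed
  show ?thesis
  proof (cases "q = n")
    case True
    then have "z = 1" using z1 by simp
    then show ?thesis unfolding e using True by simp
  next
    case False
    then have "\<not> n dvd q" using q by (auto elim!: dvdE)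
    then have "z \<noteq> 1" using z1 by simp
    then show ?thesis unfolding e using False zn by (simp add: sum_gp_strict)
  qed
qed

text \<open>Discrete Fourier inversion. For nonzero w the weight \<kappa>^(m + 1) is w^n /
  \<kappa>^(n - 1 - m), which cancels the power attached to v m in each mode.\<close>

lemma sum_char_exponent_mode:
  assumes "m < n"
  shows "(\<Sum>j<n. char_exponent n w j ^ (m + 1) * mode n w j v) = of_nat n * w ^ n * v m"
proof -
  have "(\<Sum>j<n. char_exponent n w j ^ (m + 1) * mode n w j v)
      = (\<Sum>j<n. \<Sum>i<n. char_exponent n w j ^ (m + n - i) * v i)"
    unfolding mode_def sum_distrib_left 
  proof (intro sum.cong refl)
    fix j i assume "i \<in> {..<n}"
    then have "m + 1 + (n - 1 - i) = m + n - i" by auto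
    then show "char_exponent n w j ^ (m + 1) * (char_exponent n w j ^ (n - 1 - i) * v i) 
       = char_exponent n w j ^ (m + n - i) * v i"
      by (metis mult.assoc power_add)
  qed
  also have "\<dots> = (\<Sum>i<n. \<Sum>j<n. char_exponent n w j ^ (m + n - i) * v i)" by (rule sum.swap)
  also have "\<dots> = (\<Sum>i<n. w ^ (m + n - i) * v i * (\<Sum>j<n. cis (2 * pi * real j / real n) ^ (m + n - i)))"
    by (simp add: char_exponent_def power_mult_distrib sum_distrib_left mult_ac)
  also have "\<dots> = (\<Sum>i<n. if i = m then w ^ n * v m * of_nat n else 0)"
    using assms by (intro sum.cong refl) (subst sum_cis_roots_of_unity, auto)
  also have "\<dots> = of_nat n * w ^ n * v m" using assms by simp
  finally show ?thesis .
qed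

lemma mode_scale: "mode n w j (\<lambda>i. c * v i) = c * mode n w j v"
  by (simp add: mode_def sum_distrib_left mult_ac)

lemma mode_add: "mode n w j (\<lambda>i. u i + v i) = mode n w j u + mode n w j v"
  by (simp add: mode_def sum.distrib algebra_simps)

lemma indef_form_scale: "indef_form n w c (\<lambda>i. r * v i) = (norm r)\<^sup>2 * indef_form n w c v"
  by (simp add: indef_form_def mode_scale norm_mult power_mult_distrib sum_distrib_left mult_ac)

lemma sum_norm_mode_pos:
  assumes "w \<noteq> 0" "\<exists>i<n. v i \<noteq> 0"
  shows "0 < (\<Sum>j<n. (norm (mode n w j v))\<^sup>2)"
proof (rule ccontr)
  assume "\<not> ?thesis"
  then have "(\<Sum>j<n. (norm (mode n w j v))\<^sup>2) = 0" by (metis less_eq_real_def not_le sum_nonneg zero_le_power2)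
  then have z: "mode n w j v = 0" if "j < n" for j
    using that by (subst (asm) sum_nonneg_eq_0_iff) auto
  obtain i where i: "i < n" "v i \<noteq> 0" using assms by blast
  have "of_nat n * w ^ n * v i = 0"
    using z by (subst sum_char_exponent_mode[OF i(1), symmetric]) simp
  then show False using i assms by simp
qed

text \<open>Only the last component of the system contains the coefficients, and it enters every
  mode with weight 1; so one and the same perturbation appears in all modes.\<close>

lemma mode_has_vector_derivative:
  assumes sys: "forced_system n p (w^n) (\<lambda>_. 0) y" and n: "n \<ge> 2"
  shows "((\<lambda>x. mode n w j (\<lambda>i. y i x)) has_vector_derivative
     (char_exponent n w j * mode n w j (\<lambda>i. y i x) - (\<Sum>k\<le>n-2. p k x * y k x))) (at x)"
proof -
  let ?\<kappa> = "char_exponent n w j"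
  obtain N where N: "n = Suc N" using n by (cases n) auto
  define g where "g = (\<Sum>k\<le>n-2. p k x * y k x)"
  define d where "d = (\<lambda>i. if Suc i = n then w^n * y 0 x - g + 0 else y (Suc i) x)"
  have "((\<lambda>x. mode n w j (\<lambda>i. y i x)) has_vector_derivative (\<Sum>i<n. ?\<kappa> ^ (n-1-i) * d i)) (at x)"
    unfolding mode_def d_def g_def
    by (intro has_vector_derivative_sum has_vector_derivative_mult_right)
       (use sys in \<open>auto simp only: forced_system_def lessThan_iff\<close>)
  also have "(\<Sum>i<n. ?\<kappa> ^ (n-1-i) * d i) = (\<Sum>i<N. ?\<kappa> ^ (N-i) * y (Suc i) x) + (w^n * y 0 x - g)"
    unfolding N by (simp add: d_def N)
  also have "(\<Sum>i<N. ?\<kappa> ^ (N-i) * y (Suc i) x) = ?\<kappa> * mode n w j (\<lambda>i. y i x) - ?\<kappa>^n * y 0 x"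
  proof -
    have "?\<kappa> * mode n w j (\<lambda>i. y i x) = (\<Sum>i<Suc N. ?\<kappa> ^ (Suc N - i) * y i x)"
      unfolding mode_def N sum_distrib_left
      by (intro sum.cong refl) (simp add: Suc_diff_le flip: mult.assoc power_Suc)
    also have "\<dots> = ?\<kappa>^n * y 0 x + (\<Sum>i<N. ?\<kappa> ^ (N - i) * y (Suc i) x)"
      by (subst sum.lessThan_Suc_shift) (simp add: N)
    finally show ?thesis by simp
  qed
  finally show ?thesis using n by (simp add: char_exponent_power g_def)
qed

text \<open>Inversion expresses v m through the modes with weights of modulus |w|^(m + 1 - n) / n,
  and m <= n - 2 leaves at least one factor 1 / |w|. The 1 / n offsets the number of
  coefficients.\<close>

lemma norm_coefficient_sum_le:
  assumes n: "n \<ge> 2" and w: "norm w \<ge> 1"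
    and B: "\<And>k. k \<le> n-2 \<Longrightarrow> norm (q k) \<le> B" "B \<ge> 0"
  shows "norm (\<Sum>k\<le>n-2. q k * v k) \<le> B / norm w * (\<Sum>j<n. norm (mode n w j v))"
proof -
  define S where "S = (\<Sum>j<n. norm (mode n w j v))"
  have S0: "S \<ge> 0" unfolding S_def by (intro sum_nonneg) auto
  have vm: "norm (v m) \<le> S / (n * norm w)" if m: "m \<le> n - 2" for m
  proof -
    have mn: "m < n" using m n by auto
    have "n * norm w ^ n * norm (v m) = norm (\<Sum>j<n. char_exponent n w j ^ (m + 1) * mode n w j v)"
      unfolding sum_char_exponent_mode[OF mn] by (simp add: norm_mult norm_power)
    also have "\<dots> \<le> (\<Sum>j<n. norm w ^ (m+1) * norm (mode n w j v))"
      by (intro sum_norm_le) (simp add: norm_mult norm_power)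
    also have "\<dots> = norm w ^ (m+1) * S" by (simp add: S_def sum_distrib_left)
    also have "\<dots> \<le> norm w ^ (n-1) * S"
      using w m n S0 by (intro mult_right_mono power_increasing) auto
    finally have "norm w ^ (n-1) * (n * norm w * norm (v m)) \<le> norm w ^ (n-1) * S"
      using n power_Suc[of "norm w" "n-1"] by (simp add: mult_ac)
    then have "n * norm w * norm (v m) \<le> S"
      using w zero_less_power[of "norm w" "n-1"] by (subst (asm) mult_le_cancel_left_pos) linarith+
    moreover have "n * norm w > 0" using n w by (intro mult_pos_pos) auto
    ultimately show ?thesis by (simp add: pos_le_divide_eq mult_ac)
  qed
  have "norm (\<Sum>k\<le>n-2. q k * v k) \<le> (\<Sum>k\<le>n-2. B * (S / (n * norm w)))"
  proof (intro sum_norm_le)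
    fix k assume "k \<in> {..n-2}"
    then show "norm (q k * v k) \<le> B * (S / (n * norm w))"
      unfolding norm_mult using B vm by (intro mult_mono) auto
  qed
  also have "\<dots> = real (n - 1) * (B * (S / (n * norm w)))" using n by simp
  also have "\<dots> \<le> real n * (B * (S / (n * norm w)))"
    using B S0 by (intro mult_right_mono) auto
  also have "\<dots> = B / norm w * S" using n by simp
  finally show ?thesis unfolding S_def .
qed

text \<open>Since the equation has no term of order \<open>n - 1\<close>, the coefficients perturb the modes
  only by a relative amount \<open>O(1/|w|)\<close>, which the dichotomy of size \<open>\<epsilon>|w|\<close> absorbs.\<close>

lemma indef_form_increases:
  fixes y p :: "nat \<Rightarrow> real \<Rightarrow> complex" and B b c \<epsilon> :: real
  assumes sys: "forced_system n p (w^n) (\<lambda>_. 0) y" and n: "n \<ge> 2" and b: "b > 0"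
    and B: "\<And>k x. k \<le> n-2 \<Longrightarrow> 0 \<le> x \<Longrightarrow> x \<le> b \<Longrightarrow> norm (p k x) \<le> B" "B \<ge> 0"
    and w: "norm w \<ge> 1" "\<epsilon> * norm w > n * B"
    and gap: "\<And>j. j < n \<Longrightarrow> \<bar>Re (char_exponent n w j) - c * norm w\<bar> \<ge> \<epsilon> * norm w"
    and nz: "\<exists>i<n. y i 0 \<noteq> 0"
  shows "indef_form n w c (\<lambda>i. y i 0) < exp (- 2 * c * norm w * b) * indef_form n w c (\<lambda>i. y i b)"
proof -
  define \<sigma> where "\<sigma> = (\<lambda>j. sgn (Re (char_exponent n w j) - c * norm w))"
  define Z where "Z = (\<lambda>j x. mode n w j (\<lambda>i. y i x))"
  define g where "g = (\<lambda>x. \<Sum>k\<le>n-2. p k x * y k x)"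
  define H where "H = (\<lambda>x. \<Sum>j<n. \<sigma> j * (norm (Z j x))\<^sup>2)"
  define H' where "H' = (\<lambda>x. \<Sum>j<n. \<sigma> j * (2 * Re (cnj (Z j x) * (char_exponent n w j * Z j x - g x))))"
  define W where "W = (\<lambda>x. exp (- 2 * c * norm w * x) * H x)"
  define W' where "W' = (\<lambda>x. exp (- 2 * c * norm w * x) * (H' x - 2 * c * norm w * H x))"
  have Hform: "H x = indef_form n w c (\<lambda>i. y i x)" for x
    by (simp add: H_def indef_form_def \<sigma>_def Z_def)
  have dH: "(H has_real_derivative H' x) (at x)" for x
    unfolding H_def H'_def Z_def g_def
    by (intro DERIV_sum DERIV_cmult norm_power2_has_real_derivative mode_has_vector_derivative sys n)
  have dW: "(W has_real_derivative W' x) (at x)" for x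
    unfolding W_def W'_def by (rule derivative_eq_intros dH refl)+ (simp add: algebra_simps)
  define N where "N = (\<lambda>x. \<Sum>j<n. (norm (Z j x))\<^sup>2)"
  have N0: "N x \<ge> 0" for x unfolding N_def by (intro sum_nonneg) auto
  \<comment> \<open>Each mode gains 2 * \<epsilon> * |w| * |z|^2, since its sign agrees with the
    side of the level on which \<kappa> lies. The common perturbation costs at most 2 * |g| * S, and
    Cauchy-Schwarz for S turns this into 2 * n * B * N.\<close>
  have lower: "W' x \<ge> exp (- 2 * c * norm w * x) * (2 * (\<epsilon> * norm w - n * B) * N x)" if x: "0 \<le> x" "x \<le> b" for x
  proof -
    define S where "S = (\<Sum>j<n. norm (Z j x))"
    have S0: "S \<ge> 0" unfolding S_def by (intro sum_nonneg) auto
    have gle: "norm (g x) \<le> B / norm w * S"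
      unfolding g_def S_def Z_def using B x w(1) n by (intro norm_coefficient_sum_le) auto
    have S2: "S\<^sup>2 \<le> N x * n"
      unfolding S_def N_def using sum_squared_le_sum_of_squares[of "\<lambda>j. norm (Z j x)" "{..<n}"] by simp
    have "norm (g x) * S \<le> B / norm w * S * S" using gle S0 by (rule mult_right_mono)
    also have "\<dots> = B / norm w * S\<^sup>2" by (simp add: power2_eq_square)
    also have "\<dots> \<le> B / norm w * (N x * n)" using S2 B w(1) by (intro mult_left_mono) auto
    also have "\<dots> \<le> B / 1 * (N x * n)" using B w(1) N0 by (intro mult_right_mono divide_left_mono) auto
    finally have gS: "norm (g x) * S \<le> n * B * N x" by (simp add: mult_ac)
    have "H' x - 2 * c * norm w * H x 
      = (\<Sum>j<n. \<sigma> j * (2 * Re (cnj (Z j x) * (char_exponent n w j * Z j x - g x))) - 2 * c * norm w * (\<sigma> j * (norm (Z j x))\<^sup>2))"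
      by (simp add: H'_def H_def sum_subtractf sum_distrib_left)
    also have "\<dots> \<ge> (\<Sum>j<n. 2 * (\<epsilon> * norm w) * (norm (Z j x))\<^sup>2 - 2 * norm (g x) * norm (Z j x))"
    proof (rule sum_mono)
      fix j assume "j \<in> {..<n}"
      let ?k = "char_exponent n w j"
      have sa: "\<sigma> j * (Re ?k - c * norm w) = \<bar>Re ?k - c * norm w\<bar>" unfolding \<sigma>_def by (simp add: abs_sgn mult.commute)
      have e: "Re (cnj (Z j x) * (?k * Z j x - g x)) = Re ?k * (norm (Z j x))\<^sup>2 - Re (cnj (Z j x) * g x)"
        unfolding cmod_power2 by (simp add: algebra_simps power2_eq_square)
      have s1: "\<bar>\<sigma> j\<bar> \<le> 1" unfolding \<sigma>_def by (simp add: sgn_if)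
      have "\<sigma> j * Re (cnj (Z j x) * g x) \<le> \<bar>\<sigma> j * Re (cnj (Z j x) * g x)\<bar>" by simp
      also have "\<dots> \<le> 1 * norm (cnj (Z j x) * g x)"
        unfolding abs_mult by (intro mult_mono s1 abs_Re_le_cmod) auto
      finally have r: "\<sigma> j * Re (cnj (Z j x) * g x) \<le> norm (g x) * norm (Z j x)" by (simp add: norm_mult mult.commute)
      have "\<sigma> j * (2 * Re (cnj (Z j x) * (?k * Z j x - g x))) - 2 * c * norm w * (\<sigma> j * (norm (Z j x))\<^sup>2)
         = 2 * (\<sigma> j * (Re ?k - c * norm w)) * (norm (Z j x))\<^sup>2 - 2 * (\<sigma> j * Re (cnj (Z j x) * g x))"
        unfolding e by (simp add: algebra_simps)
      also have "\<dots> \<ge> 2 * (\<epsilon> * norm w) * (norm (Z j x))\<^sup>2 - 2 * (norm (g x) * norm (Z j x))"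
        unfolding sa using r gap[of j] \<open>j \<in> _\<close> by (intro diff_mono mult_right_mono mult_left_mono) auto
      finally show "2 * (\<epsilon> * norm w) * (norm (Z j x))\<^sup>2 - 2 * norm (g x) * norm (Z j x) \<le>
        \<sigma> j * (2 * Re (cnj (Z j x) * (?k * Z j x - g x))) - 2 * c * norm w * (\<sigma> j * (norm (Z j x))\<^sup>2)" by (simp add: mult.assoc)
    qed
    finally have "H' x - 2 * c * norm w * H x \<ge> 2 * (\<epsilon> * norm w) * N x - 2 * (norm (g x) * S)"
      by (simp add: sum_subtractf N_def S_def sum_distrib_left mult.assoc)
    then have "H' x - 2 * c * norm w * H x \<ge> 2 * (\<epsilon> * norm w - n * B) * N x" using gS by (simp add: algebra_simps)
    then show ?thesis unfolding W'_def by (intro mult_left_mono) auto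
  qed
  have W'0: "W' x \<ge> 0" if "0 \<le> x" "x \<le> b" for x
    using lower[OF that] N0[of x] w(2) by (smt (verit) exp_ge_zero mult_nonneg_nonneg)
  have "N 0 > 0" unfolding N_def Z_def using w(1) nz by (intro sum_norm_mode_pos) auto
  \<comment> \<open>Strictness is gained at x = 0, where the data are nonzero; from there on
    monotonicity suffices.\<close>
  then have "W' 0 > 0" using lower[of 0] b w(2) by (smt (verit) exp_gt_zero mult_pos_pos)
  from DERIV_pos_inc_right[OF dW this] obtain d where d: "d > 0" "\<And>h. h > 0 \<Longrightarrow> h < d \<Longrightarrow> W 0 < W h" by auto
  define h where "h = min (d/2) b"
  have h: "h > 0" "h < d" "h \<le> b" using d(1) b unfolding h_def by auto
  have "W 0 < W h" using d h by blast
  also have "W h \<le> W b"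
  proof (rule DERIV_nonneg_imp_nondecreasing[OF h(3)])
    fix x assume "h \<le> x" "x \<le> b"
    then have "W' x \<ge> 0" using h(1) by (intro W'0) linarith+
    with dW[of x] show "\<exists>y. (W has_real_derivative y) (at x) \<and> y \<ge> 0" by blast
  qed
  finally show ?thesis unfolding W_def Hform by simp
qed

lemma Re_complex_of_real_mult: "Re (of_real x * z) = x * Re z"
  by simp

text \<open>The form has at most one positive square, and the upper triangular map expands every
  direction; the point of \<open>y = 1\<close> at which the form is minimal is then the image of a point
  with a smaller value.\<close>

lemma no_two_expanding_directions:
  fixes a d :: "nat \<Rightarrow> complex" and \<sigma> :: "nat \<Rightarrow> real" and r1 r2 s :: complex and E :: real and n :: nat
  defines "h \<equiv> \<lambda>x y. \<Sum>j<n. \<sigma> j * (norm (x * a j + y * d j))\<^sup>2"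
  assumes n: "n > 0" and \<sigma>: "\<And>j. 0 < j \<Longrightarrow> j < n \<Longrightarrow> \<sigma> j \<le> 0"
    and r: "E * (norm r1)\<^sup>2 \<ge> 1" "E * (norm r2)\<^sup>2 \<ge> 1"
    and incr: "\<And>x y. (x, y) \<noteq> (0, 0) \<Longrightarrow> h x y < E * h (x * r1 + y * s) (y * r2)"
  shows False
proof -
  define A where "A = h 1 0"
  have hscale: "h (c * x) (c * y) = (norm c)\<^sup>2 * h x y" for c x y
  proof -
    have "c * x * a j + c * y * d j = c * (x * a j + y * d j)" for j by (simp add: algebra_simps)
    then show ?thesis by (simp add: h_def norm_mult power_mult_distrib sum_distrib_left mult_ac)
  qed
  \<comment> \<open>(1, 0) is mapped to r1 times itself; under expansion by a factor at least 1 a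
    value A <= 0 could not increase.\<close>
  have A: "A > 0"
  proof (rule ccontr)
    assume "\<not> A > 0"
    then have "E * (norm r1)\<^sup>2 * A \<le> 1 * A" using r(1) by (intro mult_right_mono_neg) auto
    moreover have "A < E * h (r1 * 1) (r1 * 0)" using incr[of 1 0] by (simp add: A_def)
    ultimately show False unfolding hscale by (simp add: A_def mult_ac)
  qed
  have nonpos: "h x y \<le> 0" if "x * a 0 + y * d 0 = 0" for x y
    unfolding h_def
  proof (rule sum_nonpos)
    fix j assume j: "j \<in> {..<n}"
    show "\<sigma> j * (norm (x * a j + y * d j))\<^sup>2 \<le> 0"
    proof (cases "j = 0")
      case True
      then show ?thesis using that by simp
    next
      case False
      then show ?thesis using \<sigma>[of j] j by (intro mult_nonpos_nonneg) auto
    qed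
  qed
  have a0: "a 0 \<noteq> 0"
  proof
    assume "a 0 = 0"
    then have "h 1 0 \<le> 0" by (intro nonpos) simp
    then show False using A by (simp add: A_def)
  qed
  \<comment> \<open>This combination has no component 0 and meets only nonpositive signs; it shows
    that the minimum over y = 1 is at most 0.\<close>
  define t0 where "t0 = - d 0 / a 0"
  have ht0: "h t0 1 \<le> 0" using a0 by (intro nonpos) (simp add: t0_def)
  define \<beta> where "\<beta> = (\<Sum>j<n. of_real (\<sigma> j) * (a j * cnj (d j)))"
  \<comment> \<open>The minimiser of A |t|^2 + 2 Re (t \<beta>) + h0, found by completing the
    square.\<close>
  define t1 where "t1 = - cnj \<beta> / of_real A"
  define h0 where "h0 = h 0 1"
  have expand: "h t 1 = A * (norm t)\<^sup>2 + 2 * Re (t * \<beta>) + h0" for t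
  proof -
    define C where "C = (\<lambda>j. Re (t * (a j * cnj (d j))))"
    have "(norm (t * a j + 1 * d j))\<^sup>2 = (norm t)\<^sup>2 * (norm (a j))\<^sup>2 + 2 * C j + (norm (d j))\<^sup>2" for j
      unfolding cmod_power2 C_def by (simp add: algebra_simps power2_eq_square)
    then have "h t 1 = (\<Sum>j<n. \<sigma> j * ((norm t)\<^sup>2 * (norm (a j))\<^sup>2 + 2 * C j + (norm (d j))\<^sup>2))"
      unfolding h_def by simp
    also have "\<dots> = (\<Sum>j<n. (norm t)\<^sup>2 * (\<sigma> j * (norm (a j))\<^sup>2) + 2 * (\<sigma> j * C j) + \<sigma> j * (norm (d j))\<^sup>2)"
      by (simp add: algebra_simps)
    also have "\<dots> = (norm t)\<^sup>2 * A + 2 * (\<Sum>j<n. \<sigma> j * C j) + h0"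
      by (simp add: sum.distrib sum_distrib_left A_def h_def h0_def)
    also have "(\<Sum>j<n. \<sigma> j * C j) = Re (t * \<beta>)"
    proof -
      have "Re (t * \<beta>) = (\<Sum>j<n. Re (t * (of_real (\<sigma> j) * (a j * cnj (d j)))))"
        unfolding \<beta>_def sum_distrib_left by (rule Re_sum)
      moreover have "Re (t * (of_real (\<sigma> j) * (a j * cnj (d j)))) = \<sigma> j * C j" for j
        unfolding C_def by (simp only: Re_complex_of_real_mult mult.left_commute[of t])
      ultimately show ?thesis by simp
    qed
    finally show ?thesis by (simp add: mult.commute)
  qed
  have minimal: "h t1 1 \<le> h t 1" for t
  proof -
    have "h t 1 - h t1 1 = A * (norm (t - t1))\<^sup>2"
    proof -
      have b: "\<beta> = - (of_real A * cnj t1)" using A by (simp add: t1_def)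
      show ?thesis unfolding expand b cmod_power2
        by (simp add: algebra_simps power2_eq_square)
    qed
    moreover have "\<dots> \<ge> 0" using A by simp
    ultimately show ?thesis by linarith
  qed
  have r1: "r1 \<noteq> 0" using r(1) by auto
  \<comment> \<open>Chosen so that (t, 1) is mapped to r2 * (t1, 1). As the minimum is nonpositive,
    expansion can only lower it, so (t, 1) would lie strictly below the minimum.\<close>
  define t where "t = (t1 * r2 - s) / r1"
  have "h t 1 < E * h (t * r1 + 1 * s) (1 * r2)" by (rule incr) simp
  also have "t * r1 + 1 * s = r2 * t1" using r1 by (simp add: t_def)
  also have "h (r2 * t1) (1 * r2) = (norm r2)\<^sup>2 * h t1 1" using hscale[of r2 t1 1] by simp
  finally have "h t 1 < E * (norm r2)\<^sup>2 * h t1 1" by simp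
  also have "\<dots> \<le> 1 * h t1 1" using r(2) minimal[of t0] ht0 by (intro mult_right_mono_neg) auto
  finally show False using minimal[of t] by simp
qed

section \<open>Floquet multipliers\<close>

lemma cos_le_cos_of_between:
  assumes "0 \<le> a" "a \<le> t" "t \<le> 2 * pi - a"
  shows "cos t \<le> cos a"
proof (cases "t \<le> pi")
  case True
  then show ?thesis using assms by (intro cos_monotone_0_pi_le) auto
next
  case False
  have "cos (2 * pi - t) \<le> cos a" using assms False by (intro cos_monotone_0_pi_le) auto
  then show ?thesis by simp
qed

lemma cos_multiple_le:
  assumes "0 < j" "j < n"
  shows "cos (2 * pi * real j / real n) \<le> cos (2 * pi / real n)"
proof (rule cos_le_cos_of_between)
  have n: "real n > 0" using assms by simp
  have "1 * (2 * pi / real n) \<le> real j * (2 * pi / real n)" 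
    using assms by (intro mult_right_mono) auto
  then show "2 * pi / real n \<le> 2 * pi * real j / real n" by (simp add: mult_ac)
  have "real (j + 1) * (2 * pi / real n) \<le> real n * (2 * pi / real n)" 
    using assms by (intro mult_right_mono) auto
  then show "2 * pi * real j / real n \<le> 2 * pi - 2 * pi / real n"
    using n by (simp add: field_simps)
qed simp

text \<open>For r1 = r2 a second eigenvector need not exist. The first two columns of the Schur
  basis always span an invariant plane on which A is upper triangular, with off-diagonal entry
  \<open>s\<close>; their independence comes from the inverse \<open>Q\<close> of
  \<open>P\<close>.\<close>

lemma char_poly_two_invariant_directions:
  fixes A :: "complex mat"
  assumes A: "A \<in> carrier_mat n n"
    and fact: "char_poly A = (\<Prod>e\<leftarrow>r1 # r2 # es. [:- e, 1:])"
  obtains v1 v2 s where "\<And>i. i < n \<Longrightarrow> (\<Sum>j<n. A $$ (i,j) * v1 j) = r1 * v1 i"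
    "\<And>i. i < n \<Longrightarrow> (\<Sum>j<n. A $$ (i,j) * v2 j) = r2 * v2 i + s * v1 i"
    "\<And>x y. (\<And>i. i < n \<Longrightarrow> x * v1 i + y * v2 i = 0) \<Longrightarrow> x = 0 \<and> y = 0"
proof -
  obtain B P Q where dec: "schur_decomposition A (r1 # r2 # es) = (B, P, Q)" 
    by (metis prod_cases3)
  from schur_decomposition[OF A fact this]
  have sim: "similar_mat_wit A B P Q" and ut: "upper_triangular B" and diag: "diag_mat B = r1 # r2 # es" by auto
  from similar_mat_witD2[OF A sim]
  have QP: "Q * P = 1\<^sub>m n" and AP: "A = P * B * Q" 
    and car: "B \<in> carrier_mat n n" "P \<in> carrier_mat n n" "Q \<in> carrier_mat n n" by auto
  have len: "n = length (r1 # r2 # es)" using diag car unfolding diag_mat_def 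
    by (metis carrier_matD(1) length_map length_upt minus_nat.diff_0)
  then have n: "0 < n" "1 < n" by auto
  have B00: "B $$ (0,0) = r1" and B11: "B $$ (1,1) = r2"
  proof -
    have "diag_mat B ! 0 = B $$ (0,0)" "diag_mat B ! 1 = B $$ (1,1)"
      unfolding diag_mat_def using car n by auto
    then show "B $$ (0,0) = r1" "B $$ (1,1) = r2" unfolding diag by auto
  qed
  have APPB: "A * P = P * B"
  proof -
    have "A * P = P * B * (Q * P)" unfolding AP using car by (simp add: assoc_mult_mat[of _ n n _ n _ n])
    then show ?thesis using QP car by simp
  qed
  have entry: "(\<Sum>j<n. A $$ (i,j) * P $$ (j,k)) = (\<Sum>j<n. P $$ (i,j) * B $$ (j,k))" if "i < n" "k < n" for i k
  proof -
    have "(A * P) $$ (i,k) = (P * B) $$ (i,k)" using APPB by simp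
    then show ?thesis using that car A by (simp add: scalar_prod_def atLeast0LessThan)
  qed
  have low: "B $$ (j, k) = 0" if "k < j" "j < n" for j k using ut car that by auto
  have inv: "(\<Sum>i<n. Q $$ (k,i) * P $$ (i,l)) = (if k = l then 1 else 0)" if "k < n" "l < n" for k l
  proof -
    have "(Q * P) $$ (k,l) = 1\<^sub>m n $$ (k,l)" using QP by simp
    then show ?thesis using that car by (simp add: scalar_prod_def atLeast0LessThan)
  qed
  show ?thesis
  proof (rule that[of "\<lambda>i. P $$ (i,0)" "\<lambda>i. P $$ (i,1)" "B $$ (0,1)"])
    fix i assume i: "i < n"
    have "(\<Sum>j<n. P $$ (i,j) * B $$ (j,0)) = (\<Sum>j\<in>{0}. P $$ (i,j) * B $$ (j,0))"
      using low n by (intro sum.mono_neutral_right) auto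
    then show "(\<Sum>j<n. A $$ (i,j) * P $$ (j,0)) = r1 * P $$ (i,0)"
      using entry[OF i n(1)] B00 by (simp add: mult.commute)
    have "(\<Sum>j<n. P $$ (i,j) * B $$ (j,1)) = (\<Sum>j\<in>{0,1}. P $$ (i,j) * B $$ (j,1))"
      using low n by (intro sum.mono_neutral_right) auto
    then show "(\<Sum>j<n. A $$ (i,j) * P $$ (j,1)) = r2 * P $$ (i,1) + B $$ (0,1) * P $$ (i,0)"
      using entry[OF i n(2)] B11 by (simp add: mult.commute)
  next
    fix x y assume z: "\<And>i. i < n \<Longrightarrow> x * P $$ (i,0) + y * P $$ (i,1) = 0"
    have "(\<Sum>i<n. Q $$ (k,i) * (x * P $$ (i,0) + y * P $$ (i,1)))
       = x * (\<Sum>i<n. Q $$ (k,i) * P $$ (i,0)) + y * (\<Sum>i<n. Q $$ (k,i) * P $$ (i,1))" for k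
      by (simp add: algebra_simps sum.distrib sum_distrib_left)
    moreover have "(\<Sum>i<n. Q $$ (k,i) * (x * P $$ (i,0) + y * P $$ (i,1))) = 0" for k
      using z by (intro sum.neutral) auto
    ultimately have e: "x * (\<Sum>i<n. Q $$ (k,i) * P $$ (i,0)) + y * (\<Sum>i<n. Q $$ (k,i) * P $$ (i,1)) = 0" for k by metis
    show "x = 0 \<and> y = 0" using e[of 0] e[of 1] inv n by simp
  qed
qed

locale fundamental_system =
  fixes n :: nat and b :: real
    and p :: "nat \<Rightarrow> real \<Rightarrow> complex"
    and u :: "nat \<Rightarrow> complex \<Rightarrow> real \<Rightarrow> complex"
  assumes n2: "n \<ge> 2" and bpos: "b > 0"
    and p_smooth: "\<And>k. k \<le> n - 2 \<Longrightarrow> smooth_fun (p k)"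
    and u_diff: "\<And>j lam. j < n \<Longrightarrow> differentiable_n n (u j lam)"
    and u_ode: "\<And>j lam x. j < n \<Longrightarrow>
        vderiv n (u j lam) x + (\<Sum>k\<le>n - 2. p k x * vderiv k (u j lam) x) = lam * u j lam x"
    and u_init: "\<And>i j lam. i < n \<Longrightarrow> j < n \<Longrightarrow>
        vderiv i (u j lam) 0 = (if i = j then 1 else 0)"
begin

definition floquet :: "complex \<Rightarrow> complex mat" where
  "floquet lam = mat n n (\<lambda>(i, j). vderiv i (u j lam) b)"

lemma floquet_carrier [simp]: "floquet lam \<in> carrier_mat n n"
  by (simp add: floquet_def)

lemma fundamental_forced_system:
  assumes "j < n"
  shows "forced_system n p lam (\<lambda>_. 0) (\<lambda>i. vderiv i (u j lam))"
proof (rule forced_systemI)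
  have d: "(vderiv k (u j lam) has_vector_derivative vderiv (Suc k) (u j lam) x) (at x)" if "k < n" for k x
    using u_diff[OF assms] that unfolding differentiable_n_def by blast
  then show "i < n \<Longrightarrow> Suc i \<noteq> n \<Longrightarrow> (vderiv i (u j lam) has_vector_derivative vderiv (Suc i) (u j lam) x) (at x)" for i x
    by blast
  fix i x assume i: "Suc i = n"
  have "vderiv 0 (u j lam) x = u j lam x" by (simp add: vderiv_def)
  then have "vderiv n (u j lam) x = lam * vderiv 0 (u j lam) x - (\<Sum>k\<le>n-2. p k x * vderiv k (u j lam) x) + 0"
    using u_ode[OF assms, of lam x] by (simp add: algebra_simps)
  moreover have "(vderiv i (u j lam) has_vector_derivative vderiv n (u j lam) x) (at x)" using d[of i x] i by simp
  ultimately show "(vderiv i (u j lam) has_vector_derivative 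
     lam * vderiv 0 (u j lam) x - (\<Sum>k\<le>n-2. p k x * vderiv k (u j lam) x) + 0) (at x)" by simp
qed

lemma coefficients_bounded:
  obtains B where "B \<ge> 0" "\<And>k x. k \<le> n-2 \<Longrightarrow> 0 \<le> x \<Longrightarrow> x \<le> b \<Longrightarrow> norm (p k x) \<le> B"
proof -
  have "\<exists>B. \<forall>x\<in>{0..b}. norm (p k x) \<le> B" if "k \<le> n - 2" for k
  proof -
    have "(p k has_vector_derivative vderiv (Suc 0) (p k) x) (at x)" for x
      using p_smooth[OF that] unfolding smooth_fun_def by (metis vderiv_def funpow_0)
    then have "continuous_on {0..b} (p k)"
      by (meson continuous_at_imp_continuous_on has_vector_derivative_continuous)
    then have "bounded (p k ` {0..b})" by (intro compact_imp_bounded compact_continuous_image) auto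
    then show ?thesis by (auto simp: bounded_iff)
  qed
  then obtain C where C: "\<And>k x. k \<le> n - 2 \<Longrightarrow> x \<in> {0..b} \<Longrightarrow> norm (p k x) \<le> C k" by metis
  show ?thesis
  proof (rule that[of "\<Sum>k\<le>n-2. \<bar>C k\<bar>"])
    fix k x assume k: "k \<le> n-2" "0 \<le> x" "x \<le> b"
    have "norm (p k x) \<le> \<bar>C k\<bar>" using C[of k x] k by simp
    also have "\<dots> \<le> (\<Sum>k\<le>n-2. \<bar>C k\<bar>)" using k by (intro member_le_sum) auto
    finally show "norm (p k x) \<le> (\<Sum>k\<le>n-2. \<bar>C k\<bar>)" .
  qed (auto intro: sum_nonneg)
qed

lemma floquet_entry_holomorphic:
  assumes "i < n" "j < n"
  shows "(\<lambda>lam. floquet lam $$ (i, j)) holomorphic_on UNIV"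
proof -
  obtain B where B: "B \<ge> 0" "\<And>k x. k \<le> n-2 \<Longrightarrow> 0 \<le> x \<Longrightarrow> x \<le> b \<Longrightarrow> norm (p k x) \<le> B"
    by (rule coefficients_bounded) blast
  have "(\<lambda>lam. vderiv i (u j lam) b) holomorphic_on UNIV"
    by (rule fundamental_solutions_entire[OF n2 bpos B(2,1) fundamental_forced_system[OF assms(2)] u_init[OF _ assms(2)] assms(1)])
  then show ?thesis using assms by (simp add: floquet_def)
qed

definition coefficient_bound :: real where
  "coefficient_bound = (SOME B. B \<ge> 0 \<and> (\<forall>k x. k \<le> n-2 \<longrightarrow> 0 \<le> x \<longrightarrow> x \<le> b \<longrightarrow> norm (p k x) \<le> B))"

lemma coefficient_bound:
  "coefficient_bound \<ge> 0" 
  "k \<le> n-2 \<Longrightarrow> 0 \<le> x \<Longrightarrow> x \<le> b \<Longrightarrow> norm (p k x) \<le> coefficient_bound"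
proof -
  have "\<exists>B. B \<ge> 0 \<and> (\<forall>k x. k \<le> n-2 \<longrightarrow> 0 \<le> x \<longrightarrow> x \<le> b \<longrightarrow> norm (p k x) \<le> B)"
    by (rule coefficients_bounded) blast
  from someI_ex[OF this, folded coefficient_bound_def] show "coefficient_bound \<ge> 0" 
    "k \<le> n-2 \<Longrightarrow> 0 \<le> x \<Longrightarrow> x \<le> b \<Longrightarrow> norm (p k x) \<le> coefficient_bound" by auto
qed

text \<open>The Floquet matrix carries the data of a solution at 0 to its data at b, so monotonicity
  along solutions becomes an inequality between v and its image.\<close>

lemma indef_form_floquet:
  assumes w: "norm w \<ge> 1" "\<epsilon> * norm w > n * coefficient_bound"
    and gap: "\<And>j. j < n \<Longrightarrow> \<bar>Re (char_exponent n w j) - c * norm w\<bar> \<ge> \<epsilon> * norm w"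
    and nz: "\<exists>i<n. v i \<noteq> 0"
  shows "indef_form n w c v < exp (- 2 * c * norm w * b) * indef_form n w c (\<lambda>i. \<Sum>j<n. floquet (w^n) $$ (i,j) * v j)"
proof -
  define y where "y = (\<lambda>i x. \<Sum>j<n. v j * vderiv i (u j (w^n)) x)"
  have cong: "indef_form n w c v1 = indef_form n w c v2" if "\<And>i. i < n \<Longrightarrow> v1 i = v2 i" for v1 v2
    using that by (simp add: indef_form_def mode_def)
  have sys: "forced_system n p (w^n) (\<lambda>_. 0) y"
    unfolding y_def by (intro forced_system_sum fundamental_forced_system) auto
  have y0: "y i 0 = v i" if "i < n" for i
  proof -
    have "y i 0 = (\<Sum>j<n. if j = i then v j else 0)"
      unfolding y_def using u_init that by (intro sum.cong) auto
    then show ?thesis using that by simp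
  qed
  have yb: "y i b = (\<Sum>j<n. floquet (w^n) $$ (i,j) * v j)" if "i < n" for i
    unfolding y_def floquet_def using that by (simp add: mult.commute)
  have "indef_form n w c (\<lambda>i. y i 0) < exp (- 2 * c * norm w * b) * indef_form n w c (\<lambda>i. y i b)"
    using nz y0 by (intro indef_form_increases[OF sys n2 bpos coefficient_bound(2) coefficient_bound(1) w gap]) auto
  then show ?thesis using cong[of "\<lambda>i. y i 0" v] y0 cong[of "\<lambda>i. y i b"] yb by simp
qed

lemma root_imp_eigenvector:
  assumes "poly (char_poly (floquet lam)) r = 0"
  obtains v where "\<exists>i<n. v i \<noteq> 0" "\<And>i. i < n \<Longrightarrow> (\<Sum>j<n. floquet lam $$ (i,j) * v j) = r * v i"
proof -
  have "eigenvalue (floquet lam) r" using assms by (simp add: eigenvalue_root_char_poly[OF floquet_carrier])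
  then obtain v where v: "v \<in> carrier_vec n" "v \<noteq> 0\<^sub>v n" "floquet lam *\<^sub>v v = r \<cdot>\<^sub>v v"
    unfolding eigenvalue_def eigenvector_def by (auto simp: floquet_def)
  show ?thesis
  proof (rule that[of "\<lambda>i. v $ i"])
    show "\<exists>i<n. v $ i \<noteq> 0"
    proof (rule ccontr)
      assume "\<not> ?thesis"
      then have "v = 0\<^sub>v n" using v(1) by (intro eq_vecI) auto
      then show False using v(2) by simp
    qed
    fix i assume i: "i < n"
    have "(floquet lam *\<^sub>v v) $ i = (r \<cdot>\<^sub>v v) $ i" using v by simp
    then show "(\<Sum>j<n. floquet lam $$ (i,j) * v $ j) = r * v $ i"
      using i v(1) by (simp add: scalar_prod_def floquet_def atLeast0LessThan)
  qed
qed

text \<open>On an eigenvector the form is multiplied by |r|^2. The strict inequality therefore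
  excludes |r| = exp (c |w| b), and the sign of the form tells on which side of this level |r|
  lies.\<close>

lemma multiplier_form:
  assumes w: "norm w \<ge> 1" "\<epsilon> * norm w > n * coefficient_bound"
    and gap: "\<And>j. j < n \<Longrightarrow> \<bar>Re (char_exponent n w j) - c * norm w\<bar> \<ge> \<epsilon> * norm w"
    and root: "poly (char_poly (floquet (w^n))) r = 0"
  obtains v where "\<exists>i<n. v i \<noteq> 0"
    "indef_form n w c v < (norm r / exp (c * norm w * b))\<^sup>2 * indef_form n w c v"
proof -
  obtain v where v: "\<exists>i<n. v i \<noteq> 0" "\<And>i. i < n \<Longrightarrow> (\<Sum>j<n. floquet (w^n) $$ (i,j) * v j) = r * v i"
    using root_imp_eigenvector[OF root] by blast
  have "indef_form n w c (\<lambda>i. \<Sum>j<n. floquet (w^n) $$ (i,j) * v j) = indef_form n w c (\<lambda>i. r * v i)"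
    using v(2) by (simp add: indef_form_def mode_def)
  also have "\<dots> = (norm r)\<^sup>2 * indef_form n w c v" by (rule indef_form_scale)
  finally have "indef_form n w c v < exp (- 2 * c * norm w * b) * ((norm r)\<^sup>2 * indef_form n w c v)"
    using indef_form_floquet[OF w gap v(1)] by simp
  moreover have "exp (- 2 * c * norm w * b) = (1 / exp (c * norm w * b))\<^sup>2"
    by (simp add: power2_eq_square exp_minus field_simps flip: exp_add)
  ultimately have "indef_form n w c v < (norm r / exp (c * norm w * b))\<^sup>2 * indef_form n w c v"
    by (simp add: power_divide)
  then show ?thesis using that v(1) by blast
qed

lemma multiplier_norm_neq:
  assumes w: "norm w \<ge> 1" "\<epsilon> * norm w > n * coefficient_bound"
    and gap: "\<And>j. j < n \<Longrightarrow> \<bar>Re (char_exponent n w j) - c * norm w\<bar> \<ge> \<epsilon> * norm w"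
    and root: "poly (char_poly (floquet (w^n))) r = 0"
  shows "norm r \<noteq> exp (c * norm w * b)"
proof
  assume "norm r = exp (c * norm w * b)"
  with multiplier_form[OF assms] show False by auto
qed

lemma indef_form_all_signs:
  assumes w: "w \<noteq> 0" and nz: "\<exists>i<n. v i \<noteq> 0" 
    and s: "\<And>j. j < n \<Longrightarrow> sgn (Re (char_exponent n w j) - c * norm w) = s"
  shows "indef_form n w c v = s * (\<Sum>j<n. (norm (mode n w j v))\<^sup>2)"
  using s by (simp add: indef_form_def sum_distrib_left)

lemma abs_Re_char_exponent_le: "\<bar>Re (char_exponent n w j)\<bar> \<le> norm w"
  using abs_Re_le_cmod[of "char_exponent n w j"] by simp

text \<open>At c = 2 the level lies above every Re \<kappa> <= |w|; the form is negative definite,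
  and its increase means contraction relative to exp (2 |w| b).\<close>

lemma multiplier_norm_less:
  assumes w: "norm w \<ge> 1" "norm w > n * coefficient_bound"
    and root: "poly (char_poly (floquet (w^n))) r = 0"
  shows "norm r < exp (2 * norm w * b)"
proof -
  have a: "Re (char_exponent n w j) - 2 * norm w \<le> - (1 * norm w)" for j 
    using abs_Re_char_exponent_le[of w j] by auto
  obtain v where v: "\<exists>i<n. v i \<noteq> 0"
    "indef_form n w 2 v < (norm r / exp (2 * norm w * b))\<^sup>2 * indef_form n w 2 v"
  proof (rule multiplier_form[of w 1 2, OF w(1) _ _ root])
    show "\<bar>Re (char_exponent n w j) - 2 * norm w\<bar> \<ge> 1 * norm w" for j using a[of j] by linarith
  qed (use w that in auto)
  have w0: "w \<noteq> 0" using w by auto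
  define S where "S = (\<Sum>j<n. (norm (mode n w j v))\<^sup>2)"
  have S: "S > 0" unfolding S_def by (rule sum_norm_mode_pos[OF w0 v(1)])
  have "indef_form n w 2 v = (-1) * S" unfolding S_def
  proof (rule indef_form_all_signs[OF w0 v(1)])
    fix j
    have "Re (char_exponent n w j) - 2 * norm w < 0" using a[of j] w(1) by linarith
    then show "sgn (Re (char_exponent n w j) - 2 * norm w) = -1" by simp
  qed
  with v(2) have "(norm r / exp (2 * norm w * b))\<^sup>2 * S < 1 * S" by simp
  then have "(norm r / exp (2 * norm w * b))\<^sup>2 < 1" using S by (simp only: mult_less_cancel_right_pos)
  then have "norm r / exp (2 * norm w * b) < 1" by (metis abs_square_less_1 abs_less_iff)
  then show ?thesis by simp
qed

text \<open>Dually, c = -2 makes the form positive definite. The bound keeps the growth exponents of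
  a factor from being minus infinity.\<close>

lemma multiplier_norm_greater:
  assumes w: "norm w \<ge> 1" "norm w > n * coefficient_bound"
    and root: "poly (char_poly (floquet (w^n))) r = 0"
  shows "norm r > exp (- 2 * norm w * b)"
proof -
  have a: "Re (char_exponent n w j) - (-2) * norm w \<ge> 1 * norm w" for j 
    using abs_Re_char_exponent_le[of w j] by auto
  obtain v where v: "\<exists>i<n. v i \<noteq> 0"
    "indef_form n w (-2) v < (norm r / exp (-2 * norm w * b))\<^sup>2 * indef_form n w (-2) v"
  proof (rule multiplier_form[of w 1 "-2", OF w(1) _ _ root])
    show "\<bar>Re (char_exponent n w j) - (-2) * norm w\<bar> \<ge> 1 * norm w" for j using a[of j] by linarith
  qed (use w that in auto)
  have w0: "w \<noteq> 0" using w by auto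
  define S where "S = (\<Sum>j<n. (norm (mode n w j v))\<^sup>2)"
  have S: "S > 0" unfolding S_def by (rule sum_norm_mode_pos[OF w0 v(1)])
  have "indef_form n w (-2) v = 1 * S" unfolding S_def
  proof (rule indef_form_all_signs[OF w0 v(1)])
    fix j
    have "Re (char_exponent n w j) - (-2) * norm w > 0" using a[of j] w(1) by linarith
    then show "sgn (Re (char_exponent n w j) - (-2) * norm w) = 1" by simp
  qed
  with v(2) have "1 * S < (norm r / exp (-2 * norm w * b))\<^sup>2 * S" by simp
  then have "1 < (norm r / exp (-2 * norm w * b))\<^sup>2" using S by (simp only: mult_less_cancel_right_pos)
  then have "1 < norm r / exp (-2 * norm w * b)" by (smt (verit) divide_nonneg_nonneg exp_ge_zero norm_ge_zero power_le_one)
  then show ?thesis by (simp add: field_simps)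
qed

text \<open>For c between cos (2 pi / n) and 1 only the exponent k itself lies above the level c *
  k, so the form has a single positive square. Two roots above the level, possibly equal, would
  yield an invariant plane of expansion.\<close>

lemma dominant_multiplier_simple:
  fixes k c \<epsilon> :: real
  assumes k: "k \<ge> 1" "\<epsilon> * k > n * coefficient_bound"
    and eps: "\<epsilon> > 0" "c \<le> 1 - \<epsilon>" "c \<ge> cos (2 * pi / n) + \<epsilon>"
    and fact: "char_poly (floquet (of_real k ^ n)) = (\<Prod>e\<leftarrow>r1 # r2 # es. [:- e, 1:])"
    and r: "norm r1 \<ge> exp (c * k * b)" "norm r2 \<ge> exp (c * k * b)"
  shows False
proof -
  let ?w = "of_real k :: complex"
  let ?T = "floquet (of_real k ^ n)"
  have nw: "norm ?w = k" using k by simp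
  have Rek: "Re (char_exponent n ?w j) = k * cos (2 * pi * real j / real n)" for j
    by (simp add: char_exponent_def)
  have low: "Re (char_exponent n ?w j) - c * k \<le> - (\<epsilon> * k)" if "0 < j" "j < n" for j
  proof -
    have "k * (cos (2 * pi * real j / real n) - c) \<le> k * (- \<epsilon>)"
      using cos_multiple_le[OF that] eps k by (intro mult_left_mono) auto
    then show ?thesis unfolding Rek by (simp add: algebra_simps)
  qed
  have gap: "\<bar>Re (char_exponent n ?w j) - c * norm ?w\<bar> \<ge> \<epsilon> * norm ?w" if "j < n" for j
  proof (cases "j = 0")
    case True
    have "k * (1 - c) \<ge> k * \<epsilon>" using eps k by (intro mult_left_mono) auto
    then show ?thesis unfolding Rek nw using True by (simp add: algebra_simps)
  next
    case False
    then show ?thesis unfolding nw using low[of j] that by linarith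
  qed
  obtain v1 v2 s where v: "\<And>i. i < n \<Longrightarrow> (\<Sum>j<n. ?T $$ (i,j) * v1 j) = r1 * v1 i"
    "\<And>i. i < n \<Longrightarrow> (\<Sum>j<n. ?T $$ (i,j) * v2 j) = r2 * v2 i + s * v1 i"
    "\<And>x y. (\<And>i. i < n \<Longrightarrow> x * v1 i + y * v2 i = 0) \<Longrightarrow> x = 0 \<and> y = 0"
    using char_poly_two_invariant_directions[OF floquet_carrier fact] by blast
  define E where "E = exp (- 2 * c * norm ?w * b)"
  have E: "E = (1 / exp (c * k * b))\<^sup>2" unfolding E_def nw
    by (simp add: power2_eq_square exp_minus field_simps flip: exp_add)
  have E1: "E * (norm r)\<^sup>2 \<ge> 1" if "norm r \<ge> exp (c * k * b)" for r :: complex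
  proof -
    have "1 \<le> (norm r / exp (c * k * b))\<^sup>2" using that by (simp add: one_le_power)
    then show ?thesis unfolding E by (simp add: power_divide)
  qed
  define \<sigma> where "\<sigma> = (\<lambda>j. sgn (Re (char_exponent n ?w j) - c * norm ?w))"
  have \<sigma>: "\<sigma> j \<le> 0" if "0 < j" "j < n" for j
  proof -
    have "Re (char_exponent n ?w j) - c * k < 0" using low[OF that] eps k by (smt (verit) mult_pos_pos)
    then show ?thesis unfolding \<sigma>_def nw by simp
  qed
  have form: "indef_form n ?w c (\<lambda>i. x * v1 i + y * v2 i) = (\<Sum>j<n. \<sigma> j * (norm (x * mode n ?w j v1 + y * mode n ?w j v2))\<^sup>2)" for x y
    by (simp add: indef_form_def \<sigma>_def mode_add mode_scale)
  show False
  proof (rule no_two_expanding_directions[of n \<sigma> E r1 r2 "\<lambda>j. mode n ?w j v1" "\<lambda>j. mode n ?w j v2" s, OF _ \<sigma> E1[OF r(1)] E1[OF r(2)]])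
    fix x y :: complex assume xy: "(x, y) \<noteq> (0, 0)"
    have nz: "\<exists>i<n. x * v1 i + y * v2 i \<noteq> 0" using v(3)[of x y] xy by blast
    have "(\<Sum>j<n. ?T $$ (i,j) * (x * v1 j + y * v2 j)) = (x * r1 + y * s) * v1 i + y * r2 * v2 i" if "i < n" for i
    proof -
      have "(\<Sum>j<n. ?T $$ (i,j) * (x * v1 j + y * v2 j)) = x * (\<Sum>j<n. ?T $$ (i,j) * v1 j) + y * (\<Sum>j<n. ?T $$ (i,j) * v2 j)"
        by (simp add: algebra_simps sum.distrib sum_distrib_left)
      then show ?thesis unfolding v(1)[OF that] v(2)[OF that] by (simp add: algebra_simps)
    qed
    then have "indef_form n ?w c (\<lambda>i. \<Sum>j<n. ?T $$ (i,j) * (x * v1 j + y * v2 j)) 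
       = indef_form n ?w c (\<lambda>i. (x * r1 + y * s) * v1 i + y * r2 * v2 i)"
      by (simp add: indef_form_def mode_def)
    with indef_form_floquet[of ?w \<epsilon> c, OF _ _ gap nz] k
    show "(\<Sum>j<n. \<sigma> j * (norm (x * mode n ?w j v1 + y * mode n ?w j v2))\<^sup>2)
       < E * (\<Sum>j<n. \<sigma> j * (norm ((x * r1 + y * s) * mode n ?w j v1 + y * r2 * mode n ?w j v2))\<^sup>2)"
      unfolding form[symmetric] E_def nw by simp
  qed (use n2 in auto)
qed

end

section \<open>Factorisation over the meromorphic functions\<close>

definition entire_coeffs :: "(complex \<Rightarrow> complex poly) \<Rightarrow> bool" where
  "entire_coeffs f \<longleftrightarrow> (\<forall>k. (\<lambda>z. coeff (f z) k) holomorphic_on UNIV)"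

lemma entire_coeffs_const: "entire_coeffs (\<lambda>_. q)"
  by (simp add: entire_coeffs_def)

lemma entire_coeffs_mult:
  assumes "entire_coeffs f" "entire_coeffs g"
  shows "entire_coeffs (\<lambda>z. f z * g z)"
  using assms unfolding entire_coeffs_def coeff_mult by (intro allI holomorphic_intros) auto

lemma entire_coeffs_sum:
  assumes "\<And>i. i \<in> I \<Longrightarrow> entire_coeffs (f i)"
  shows "entire_coeffs (\<lambda>z. \<Sum>i\<in>I. f i z)"
  using assms unfolding entire_coeffs_def coeff_sum by (intro allI holomorphic_intros) auto

lemma entire_coeffs_prod:
  assumes "\<And>i. i \<in> I \<Longrightarrow> entire_coeffs (f i)"
  shows "entire_coeffs (\<lambda>z. \<Prod>i\<in>I. f i z)"
  using assms
  by (induction I rule: infinite_finite_induct) (auto intro!: entire_coeffs_const entire_coeffs_mult)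

lemma entire_coeffs_char_poly:
  assumes car: "\<And>z. A z \<in> carrier_mat n n"
    and entries: "\<And>i j. i < n \<Longrightarrow> j < n \<Longrightarrow> (\<lambda>z. A z $$ (i, j)) holomorphic_on UNIV"
  shows "entire_coeffs (\<lambda>z. char_poly (A z))"
proof -
  have entry: "entire_coeffs (\<lambda>z. char_poly_matrix (A z) $$ (i, j))" if "i < n" "j < n" for i j
  proof -
    have e: "char_poly_matrix (A z) $$ (i, j) = [:- (A z $$ (i, j)), if i = j then 1 else 0:]" for z
      using that car[of z] by (auto simp: char_poly_matrix_def)
    show ?thesis unfolding entire_coeffs_def e
    proof
      fix k
      have "(\<lambda>z. coeff [:- (A z $$ (i, j)), if i = j then 1 else 0:] k) = 
         (if k = 0 then (\<lambda>z. - (A z $$ (i, j))) else (\<lambda>z. coeff [:if i = j then 1 else 0:] (k - 1)))"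
        by (auto simp: coeff_pCons split: nat.split)
      then show "(\<lambda>z. coeff [:- (A z $$ (i, j)), if i = j then 1 else 0:] k) holomorphic_on UNIV"
        using entries[OF that] by (auto intro!: holomorphic_intros)
    qed
  qed
  have "char_poly (A z) = (\<Sum>\<pi>\<in>{\<pi>. \<pi> permutes {0..<n}}. signof \<pi> * (\<Prod>i = 0..<n. char_poly_matrix (A z) $$ (i, \<pi> i)))" for z
    unfolding char_poly_def using car[of z] by (intro det_def') simp
  moreover have "entire_coeffs (\<lambda>z. \<Sum>\<pi>\<in>{\<pi>. \<pi> permutes {0..<n}}. 
      signof \<pi> * (\<Prod>i = 0..<n. char_poly_matrix (A z) $$ (i, \<pi> i)))"
  proof (intro entire_coeffs_sum entire_coeffs_mult entire_coeffs_const entire_coeffs_prod entry)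
    fix \<pi> i assume "\<pi> \<in> {\<pi>. \<pi> permutes {0..<n}}" "i \<in> {0..<n}"
    then show "i < n" "\<pi> i < n" using permutes_in_image[of \<pi> "{0..<n}" i] by auto
  qed
  ultimately show ?thesis by simp
qed

lemma entire_coeffs_continuous:
  "entire_coeffs f \<Longrightarrow> continuous_on S (\<lambda>z. coeff (f z) k)"
  unfolding entire_coeffs_def using holomorphic_on_imp_continuous_on continuous_on_subset by blast

definition monic_entire :: "nat \<Rightarrow> (complex \<Rightarrow> complex poly) \<Rightarrow> bool" where
  "monic_entire n f \<longleftrightarrow> entire_coeffs f \<and> (\<forall>z. lead_coeff (f z) = 1 \<and> degree (f z) = n)"

lemma monic_entireD:
  assumes "monic_entire n f"
  shows "entire_coeffs f" "lead_coeff (f z) = 1" "degree (f z) = n"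
  using assms by (auto simp: monic_entire_def)

lemma monic_roots_locally_bounded:
  assumes mon: "monic_entire n P" and K: "compact K"
  obtains B where "B > 0" "\<And>z r. z \<in> K \<Longrightarrow> poly (P z) r = 0 \<Longrightarrow> norm r \<le> B"
proof -
  note P = monic_entireD[OF mon]
  have "\<exists>C. \<forall>z\<in>K. norm (coeff (P z) i) \<le> C" for i
    using compact_imp_bounded[OF compact_continuous_image[OF entire_coeffs_continuous[OF P(1)] K]]
    by (auto simp: bounded_iff)
  then obtain C where C: "\<And>i z. z \<in> K \<Longrightarrow> norm (coeff (P z) i) \<le> C i" by metis
  define D where "D = (\<Sum>i<n. \<bar>C i\<bar>)"
  have D: "D \<ge> 0" unfolding D_def by (intro sum_nonneg) auto
  show ?thesis
  proof (rule that[of "1 + n * D"])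
    show "1 + n * D > 0" using D by (intro add_pos_nonneg) auto
    fix z r assume z: "z \<in> K" and root: "poly (P z) r = 0"
    have "norm r \<le> (1 + real (degree (P z)) * D) * 1"
    proof (rule root_le_of_coeffs_le[OF P(2) _ D _ root])
      fix i assume "i < degree (P z)"
      then have i: "i < n" by (simp add: P(3))
      have "norm (coeff (P z) i) \<le> \<bar>C i\<bar>" using C[OF z, of i] by simp
      also have "\<dots> \<le> D" unfolding D_def using i by (intro member_le_sum) auto
      finally show "norm (coeff (P z) i) \<le> D * 1 ^ (degree (P z) - i)" by simp
    qed simp
    then show "norm r \<le> 1 + n * D" by (simp add: P(3))
  qed
qed

text \<open>Local boundedness excludes poles. The conclusion concerns \<open>remove_sings f\<close>
  because the values of f at its singularities are arbitrary.\<close>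

lemma holomorphic_remove_sings_of_locally_bounded:
  assumes mero: "f meromorphic_on UNIV"
    and bdd: "\<And>z. \<exists>K. eventually (\<lambda>w. norm (f w) \<le> K) (at z)"
  shows "remove_sings f holomorphic_on UNIV"
proof -
  have "remove_sings f analytic_on {z}" for z
  proof -
    have iso: "isolated_singularity_at f z" and ne: "not_essential f z"
      using mero by (auto simp: meromorphic_on_altdef)
    obtain K where K: "eventually (\<lambda>w. norm (f w) \<le> K) (at z)" using bdd by blast
    have "\<not> is_pole f z"
    proof
      assume "is_pole f z"
      then have "eventually (\<lambda>w. norm (f w) \<ge> K + 1) (at z)"
        using filterlim_at_infinity_imp_norm_at_top[of f "at z"] unfolding is_pole_def filterlim_at_top by auto
      with K have "eventually (\<lambda>w. False) (at z)" by eventually_elim simp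
      then show False by simp
    qed
    then obtain c where "f \<midarrow>z\<rightarrow> c" using ne by (auto simp: not_essential_def)
    then show ?thesis using remove_sings_analytic_at iso by blast
  qed
  then have "remove_sings f analytic_on UNIV" using analytic_on_analytic_at by blast
  then show ?thesis by (rule analytic_imp_holomorphic)
qed

lemma eventually_cosparse_imp_eq:
  fixes f g :: "complex \<Rightarrow> 'a :: t2_space"
  assumes "\<forall>\<^sub>\<approx>z. f z = g z" "continuous_on UNIV f" "continuous_on UNIV g"
  shows "f = g"
proof
  fix z
  have "eventually (\<lambda>w. f w = g w) (at z)"
    using assms(1) by (rule eventually_cosparse_imp_eventually_at) auto
  moreover have "f \<midarrow>z\<rightarrow> f z" "g \<midarrow>z\<rightarrow> g z"
    using assms(2,3) by (auto simp: continuous_on_eq_continuous_at isCont_def)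
  ultimately have "f \<midarrow>z\<rightarrow> g z" by (subst tendsto_cong)
  with \<open>f \<midarrow>z\<rightarrow> f z\<close> show "f z = g z" by (rule LIM_unique)
qed

text \<open>The roots of a factor are roots of \<open>P\<close>, hence locally bounded; so the normalised
  coefficients of the factor have only removable singularities.\<close>

lemma monic_entire_part_of_factor:
  assumes P: "monic_entire n P"
    and Q: "mero_poly Q" "mero_deg_pos Q" and dvd: "\<forall>\<^sub>\<approx>z. Q z dvd P z"
  obtains d Q' where "d > 0" "monic_entire d Q'"
    "\<forall>\<^sub>\<approx>z. \<exists>c. Q z = Polynomial.smult c (Q' z)"
proof -
  \<comment> \<open>The degree of Q z may vary on a discrete set; the degree over the field is the
    largest index whose coefficient is not zero as a meromorphic function.\<close>
  define S where "S = {k. \<not> (\<forall>\<^sub>\<approx>z. coeff (Q z) k = 0)}"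
  obtain N where N: "\<And>z. degree (Q z) \<le> N" using Q(1) by (auto simp: mero_poly_def)
  have mero: "(\<lambda>z. coeff (Q z) k) meromorphic_on UNIV" for k using Q(1) by (auto simp: mero_poly_def)
  have "S \<subseteq> {..N}"
  proof
    fix k assume "k \<in> S"
    show "k \<in> {..N}"
    proof (rule ccontr)
      assume "k \<notin> {..N}"
      then have "coeff (Q z) k = 0" for z using N[of z] by (intro coeff_eq_0) auto
      then show False using \<open>k \<in> S\<close> by (simp add: S_def)
    qed
  qed
  then have finS: "finite S" by (rule finite_subset) simp
  obtain k0 where k0: "k0 \<ge> 1" "k0 \<in> S" using Q(2) by (auto simp: mero_deg_pos_def S_def)
  define d where "d = Max S"
  have "d \<in> S" using finS k0 unfolding d_def by (intro Max_in) auto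
  moreover have "d \<ge> k0" unfolding d_def using finS k0 by (intro Max_ge)
  ultimately have d: "d \<in> S" "d > 0" using k0 by auto
  have "\<forall>\<^sub>\<approx>z. coeff (Q z) k = 0" if "k > d" for k
    using that Max_ge[OF finS, of k] unfolding d_def S_def by force
  then have "\<forall>\<^sub>\<approx>z. \<forall>k\<in>{d<..N}. coeff (Q z) k = 0"
    by (intro eventually_ball_finite) auto
  \<comment> \<open>Identity theorem: a meromorphic function that is not identically zero avoids 0
    off a discrete set.\<close>
  moreover have "\<forall>\<^sub>\<approx>z. coeff (Q z) d \<noteq> 0"
    using meromorphic_imp_constant_or_avoid[OF mero, of d 0] d(1) by (auto simp: S_def)
  ultimately have deg: "\<forall>\<^sub>\<approx>z. degree (Q z) = d \<and> coeff (Q z) d \<noteq> 0"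
  proof eventually_elim
    case (elim z)
    have "coeff (Q z) k = 0" if "k > d" for k
      using elim that N[of z] by (cases "k \<le> N") (auto intro: coeff_eq_0)
    then have "degree (Q z) \<le> d" by (intro degree_le) auto
    moreover have "degree (Q z) \<ge> d" using elim by (intro le_degree) auto
    ultimately show ?case using elim by simp
  qed
  define q where "q = (\<lambda>i z. coeff (Q z) i / coeff (Q z) d)"
  have meroq: "q i meromorphic_on UNIV" for i
    unfolding q_def by (intro meromorphic_on_divide mero)
  have bdd: "\<exists>K. eventually (\<lambda>w. norm (q i w) \<le> K) (at z)" if i: "i \<le> d" for i z
  proof -
    obtain B where B: "B > 0" "\<And>w r. w \<in> cball z 1 \<Longrightarrow> poly (P w) r = 0 \<Longrightarrow> norm r \<le> B"
      using monic_roots_locally_bounded[OF P, of "cball z 1"] by auto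
    have "eventually (\<lambda>w. w \<in> cball z 1) (at z)"
      using eventually_at_ball[of 1 z UNIV] by (auto elim!: eventually_mono)
    moreover have "eventually (\<lambda>w. degree (Q w) = d \<and> coeff (Q w) d \<noteq> 0) (at z)" "eventually (\<lambda>w. Q w dvd P w) (at z)"
      using eventually_cosparse_imp_eventually_at[OF deg, of z UNIV] eventually_cosparse_imp_eventually_at[OF dvd, of z UNIV] by auto
    ultimately have "eventually (\<lambda>w. norm (q i w) \<le> 2 ^ d * B ^ (d - i)) (at z)"
    proof eventually_elim
      case (elim w)
      define Q1 where "Q1 = Polynomial.smult (1 / coeff (Q w) d) (Q w)"
      have dQ1: "degree Q1 = d" using elim by (simp add: Q1_def)
      have "norm (coeff Q1 i) \<le> 2 ^ degree Q1 * B ^ (degree Q1 - i)"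
      proof (rule coeff_le_of_roots_le)
        show "lead_coeff Q1 = 1" using elim unfolding dQ1 by (simp add: Q1_def)
        show "i \<le> degree Q1" using i dQ1 by simp
        fix r assume "poly Q1 r = 0"
        then have "poly (Q w) r = 0" using elim by (simp add: Q1_def)
        then have "poly (P w) r = 0" using elim by (auto elim!: dvdE)
        then show "norm r \<le> B" using B elim by blast
      qed
      then show ?case unfolding dQ1 by (simp add: Q1_def q_def)
    qed
    then show ?thesis by blast
  qed
  define e where "e = (\<lambda>i. remove_sings (q i))"
  have hol: "e i holomorphic_on UNIV" if "i \<le> d" for i
    unfolding e_def using meroq bdd that by (intro holomorphic_remove_sings_of_locally_bounded) auto
  have eq: "\<forall>\<^sub>\<approx>z. e i z = q i z" for i
    unfolding e_def eventually_cosparse_open_eq[OF open_UNIV]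
    using meroq[of i] by (auto simp: meromorphic_on_altdef intro: eventually_remove_sings_eq_at)
  \<comment> \<open>The top coefficient is entered as the constant 1, so that \<open>Q'\<close> is
    monic of degree d at every z and not just off a discrete set.\<close>
  define Q' where "Q' = (\<lambda>z. (\<Sum>i<d. monom (e i z) i) + monom 1 d)"
  have coeffQ': "coeff (Q' z) k = (if k < d then e k z else if k = d then 1 else 0)" for z k
    by (auto simp: Q'_def coeff_sum)
  have degQ': "degree (Q' z) = d" for z
    by (intro antisym degree_le le_degree) (auto simp: coeffQ')
  show ?thesis
  proof (rule that[OF d(2)])
    have "entire_coeffs Q'" unfolding entire_coeffs_def
    proof
      fix k
      have "(\<lambda>z. coeff (Q' z) k) = (if k < d then e k else (\<lambda>_. if k = d then 1 else 0))"
        by (auto simp: coeffQ')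
      then show "(\<lambda>z. coeff (Q' z) k) holomorphic_on UNIV" using hol[of k] by auto
    qed
    then show "monic_entire d Q'" by (simp add: monic_entire_def degQ' coeffQ')
    have "\<forall>\<^sub>\<approx>z. \<forall>i\<in>{..<d}. e i z = q i z" using eq by (intro eventually_ball_finite) auto
    with deg show "\<forall>\<^sub>\<approx>z. \<exists>c. Q z = Polynomial.smult c (Q' z)"
    proof eventually_elim
      case (elim z)
      have "Q z = Polynomial.smult (coeff (Q z) d) (Q' z)"
      proof (rule poly_eqI)
        fix k
        show "coeff (Q z) k = coeff (Polynomial.smult (coeff (Q z) d) (Q' z)) k"
          using elim by (cases k d rule: linorder_cases) (auto simp: coeffQ' q_def coeff_eq_0)
      qed
      then show ?case by blast
    qed
  qed
qed

text \<open>Monicity of P forces the two normalising scalars to multiply to 1, so the normalised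
  factors reproduce P off a discrete set; continuity of the coefficients extends this to every
  z.\<close>

lemma monic_entire_factorization:
  assumes P: "monic_entire n P"
    and Q: "mero_poly Q" "mero_deg_pos Q" and R: "mero_poly R" "mero_deg_pos R" 
    and PQR: "\<forall>\<^sub>\<approx>z. P z = Q z * R z"
  obtains Q' R' d e where "d > 0" "monic_entire d Q'"
    "e > 0" "monic_entire e R'"
    "\<And>z. P z = Q' z * R' z"
proof -
  have dvd: "\<forall>\<^sub>\<approx>z. Q z dvd P z" "\<forall>\<^sub>\<approx>z. R z dvd P z" using PQR by (auto elim: eventually_mono)
  obtain Q' d where Q': "d > 0" "monic_entire d Q'"
      "\<forall>\<^sub>\<approx>z. \<exists>c. Q z = Polynomial.smult c (Q' z)"
    by (rule monic_entire_part_of_factor[OF P Q dvd(1)])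
  obtain R' e where R': "e > 0" "monic_entire e R'"
      "\<forall>\<^sub>\<approx>z. \<exists>c. R z = Polynomial.smult c (R' z)"
    by (rule monic_entire_part_of_factor[OF P R dvd(2)])
  have ev: "\<forall>\<^sub>\<approx>z. P z = Q' z * R' z"
    using PQR Q'(3) R'(3)
  proof eventually_elim
    case (elim z)
    then obtain c c' where "P z = Polynomial.smult (c * c') (Q' z * R' z)" by (auto simp: mult_smult_left mult_smult_right)
    moreover from this have "lead_coeff (P z) = c * c' * lead_coeff (Q' z * R' z)" by (simp only: lead_coeff_smult)
    then have "1 = c * c'"
      by (simp only: lead_coeff_mult monic_entireD(2)[OF P] monic_entireD(2)[OF Q'(2)] monic_entireD(2)[OF R'(2)] mult_1_right)
    ultimately show ?case by (metis smult_1_left)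
  qed
  have "P z = Q' z * R' z" for z
  proof (rule poly_eqI)
    fix k
    have "(\<lambda>z. coeff (P z) k) = (\<lambda>z. coeff (Q' z * R' z) k)"
      by (rule eventually_cosparse_imp_eq)
         (use ev in \<open>auto elim: eventually_mono intro!: entire_coeffs_continuous entire_coeffs_mult monic_entireD(1)[OF P] monic_entireD(1)[OF Q'(2)] monic_entireD(1)[OF R'(2)]\<close>)
    then show "coeff (P z) k = coeff (Q' z * R' z) k" by metis
  qed
  then show ?thesis by (rule that[OF Q'(1,2) R'(1,2)])
qed

section \<open>Growth exponents along the rays\<close>

text \<open>\<open>e\<close> is a direction for w, so t = |lam|^(1/n) when |e| = 1. A common bound
  for all roots stands in for the largest root; the factor b is kept inside \<alpha>.\<close>

definition exponent_bound :: "nat \<Rightarrow> (complex \<Rightarrow> complex poly) \<Rightarrow> complex \<Rightarrow> real \<Rightarrow> bool" where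
  "exponent_bound n R e \<alpha> \<longleftrightarrow> (\<exists>M>0. \<forall>t\<ge>0. \<forall>r. poly (R ((of_real t * e) ^ n)) r = 0 \<longrightarrow> norm r \<le> M * exp (\<alpha> * t))"

lemma exponent_bound_of_eventually:
  assumes R: "monic_entire d R"
    and ev: "\<And>t r. t \<ge> t0 \<Longrightarrow> poly (R ((of_real t * e) ^ n)) r = 0 \<Longrightarrow> norm r \<le> M * exp (\<alpha> * t)"
  shows "exponent_bound n R e \<alpha>"
proof -
  have "compact ((\<lambda>t. (of_real t * e) ^ n) ` {0..t0})"
    by (intro compact_continuous_image continuous_intros) auto
  then obtain B where B: "B > 0" "\<And>z r. z \<in> (\<lambda>t. (of_real t * e) ^ n) ` {0..t0} \<Longrightarrow> poly (R z) r = 0 \<Longrightarrow> norm r \<le> B"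
    using monic_roots_locally_bounded[OF R] by metis
  \<comment> \<open>The second summand allows for the smallest value that exp (\<alpha> * t) can
    take on [0, t0].\<close>
  define M' where "M' = \<bar>M\<bar> + B * exp (\<bar>\<alpha>\<bar> * \<bar>t0\<bar>)"
  have M': "M' > 0" unfolding M'_def using B(1) by (intro add_nonneg_pos mult_pos_pos) auto
  have "norm r \<le> M' * exp (\<alpha> * t)" if t: "t \<ge> 0" and root: "poly (R ((of_real t * e) ^ n)) r = 0" for t r
  proof (cases "t \<ge> t0")
    case True
    have "norm r \<le> M * exp (\<alpha> * t)" by (rule ev[OF True root])
    also have "\<dots> \<le> M' * exp (\<alpha> * t)" unfolding M'_def
      by (intro mult_right_mono) (use B(1) abs_ge_self[of M] in \<open>auto intro!: add_increasing2\<close>)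
    finally show ?thesis .
  next
    case False
    have "norm r \<le> B" using B(2)[OF _ root] t False by auto
    also have "\<dots> = B * exp (\<bar>\<alpha>\<bar> * \<bar>t0\<bar>) * exp (- (\<bar>\<alpha>\<bar> * \<bar>t0\<bar>))" by (simp add: exp_minus)
    also have "\<dots> \<le> M' * exp (\<alpha> * t)"
    proof (intro mult_mono)
      have "\<bar>\<alpha> * t\<bar> \<le> \<bar>\<alpha>\<bar> * \<bar>t0\<bar>" unfolding abs_mult using t False by (intro mult_left_mono) auto
      then show "exp (- (\<bar>\<alpha>\<bar> * \<bar>t0\<bar>)) \<le> exp (\<alpha> * t)" by (subst exp_le_cancel_iff) linarith
    qed (use M' in \<open>auto simp: M'_def\<close>)
    finally show ?thesis .
  qed
  then show ?thesis using M' unfolding exponent_bound_def by blast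
qed

text \<open>Coefficient i has at most d - i times the exponents of the roots. The kink bound is
  linear in the two exponents, so it applies to each coefficient with this factor, and converting
  back to roots divides the factor out.\<close>

lemma exponent_bound_kink:
  assumes n: "n \<ge> 2" and R: "monic_entire d R"
    and growth: "\<And>w r. poly (R (w^n)) r = 0 \<Longrightarrow> norm r \<le> C * exp (C * norm w)" and C: "C > 0"
    and pos: "exponent_bound n R 1 \<alpha>" and neg: "exponent_bound n R (cis (pi/n)) \<beta>"
  shows "exponent_bound n R (cis (pi/n)) ((\<alpha> + \<beta>) / (1 + cos (pi/n)))"
proof -
  note R' = monic_entireD[OF R]
  define \<gamma> where "\<gamma> = (\<alpha> + \<beta>) / (1 + cos (pi/n))"
  obtain M1 where M1: "M1 > 0" "\<And>t r. t \<ge> 0 \<Longrightarrow> poly (R (of_real t ^ n)) r = 0 \<Longrightarrow> norm r \<le> M1 * exp (\<alpha> * t)"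
    using pos by (auto simp: exponent_bound_def)
  obtain M2 where M2: "M2 > 0" "\<And>t r. t \<ge> 0 \<Longrightarrow> poly (R ((of_real t * cis (pi/n)) ^ n)) r = 0 \<Longrightarrow> norm r \<le> M2 * exp (\<beta> * t)"
    using neg by (auto simp: exponent_bound_def)
  define M where "M = M1 + M2 + 1"
  have M: "M \<ge> 1" "M1 \<le> M" "M2 \<le> M" using M1(1) M2(1) by (auto simp: M_def)
  define D where "D = 2 ^ d * M ^ d"
  have D: "D > 0" using M unfolding D_def by simp
  have coeff_bound: "norm (coeff (R z) i) \<le> 2 ^ d * (K * exp x) ^ (d - i)"
    if "\<And>r. poly (R z) r = 0 \<Longrightarrow> norm r \<le> K * exp x" "i < d" for z i K x
    using coeff_le_of_roots_le[OF R'(2), of z "K * exp x" i] that R'(3)[of z] by simp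
  have expand: "2 ^ d * (K * exp x) ^ (d - i) \<le> 2 ^ d * K' ^ d * exp (real (d - i) * x)" 
    if "0 < K" "K \<le> K'" "1 \<le> K'" for K K' x i
  proof -
    have "K ^ (d - i) \<le> K' ^ (d - i)" using that by (intro power_mono) auto
    also have "\<dots> \<le> K' ^ d" using that by (intro power_increasing) auto
    finally show ?thesis unfolding power_mult_distrib exp_of_nat_mult[symmetric]
      by (simp add: mult_ac)
  qed
  have coeff_neg: "norm (coeff (R ((of_real t * cis (pi/n)) ^ n)) i) \<le> D * exp (\<gamma> * t) ^ (d - i)"
    if t: "t \<ge> 0" and i: "i < d" for t i
  proof -
    let ?f = "\<lambda>z. coeff (R z) i"
    \<comment> \<open>The growth hypothesis uses one constant both as factor and as rate; each
      summand covers one of these uses.\<close>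
    define C' where "C' = 2 ^ d * (C + 1) ^ d + real d * C"
    have "norm (?f ((of_real t * cis (pi/n)) ^ n)) 
        \<le> D * exp ((real (d - i) * \<alpha> + real (d - i) * \<beta>) / (1 + cos (pi/n)) * t)"
    proof (rule kink_on_negative_ray[OF n])
      show "?f holomorphic_on UNIV" using R'(1) by (auto simp: entire_coeffs_def)
      show "norm (?f (w^n)) \<le> C' * exp (C' * norm w)" for w
      proof -
        have "norm (?f (w^n)) \<le> 2 ^ d * (C * exp (C * norm w)) ^ (d - i)"
          using growth i by (intro coeff_bound)
        also have "\<dots> \<le> 2 ^ d * (C + 1) ^ d * exp (real (d - i) * (C * norm w))"
          using C by (intro expand) auto
        also have "\<dots> \<le> C' * exp (C' * norm w)"
        proof (intro mult_mono)
          have "real (d - i) * (C * norm w) \<le> real d * (C * norm w)"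
            using C by (intro mult_right_mono) auto
          also have "\<dots> \<le> C' * norm w"
            unfolding C'_def mult.assoc[symmetric] using C by (intro mult_right_mono) auto
          finally show "exp (real (d - i) * (C * norm w)) \<le> exp (C' * norm w)" by simp
        qed (use C in \<open>auto simp: C'_def intro!: add_nonneg_nonneg\<close>)
        finally show ?thesis .
      qed
      show "norm (?f (of_real t ^ n)) \<le> D * exp (real (d - i) * \<alpha> * t)" if "t \<ge> 0" for t
      proof -
        have "norm (?f (of_real t ^ n)) \<le> 2 ^ d * (M1 * exp (\<alpha> * t)) ^ (d - i)"
          using M1(2) that i by (intro coeff_bound)
        also have "\<dots> \<le> 2 ^ d * M ^ d * exp (real (d - i) * (\<alpha> * t))"
          using M1(1) M by (intro expand) auto
        finally show ?thesis by (simp add: D_def mult_ac)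
      qed
      show "norm (?f ((of_real t * cis (pi/n)) ^ n)) \<le> D * exp (real (d - i) * \<beta> * t)" if "t \<ge> 0" for t
      proof -
        have "norm (?f ((of_real t * cis (pi/n)) ^ n)) \<le> 2 ^ d * (M2 * exp (\<beta> * t)) ^ (d - i)"
          using M2(2) that i by (intro coeff_bound)
        also have "\<dots> \<le> 2 ^ d * M ^ d * exp (real (d - i) * (\<beta> * t))"
          using M2(1) M by (intro expand) auto
        finally show ?thesis by (simp add: D_def mult_ac)
      qed
    qed (use D t in auto)
    also have "(real (d - i) * \<alpha> + real (d - i) * \<beta>) / (1 + cos (pi/n)) * t = real (d - i) * (\<gamma> * t)"
      by (simp add: \<gamma>_def algebra_simps flip: add_divide_distrib)
    also have "exp (real (d - i) * (\<gamma> * t)) = exp (\<gamma> * t) ^ (d - i)" by (rule exp_of_nat_mult)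
    finally show ?thesis .
  qed
  have "norm r \<le> (1 + real d * D) * exp (\<gamma> * t)" 
    if t: "t \<ge> 0" and root: "poly (R ((of_real t * cis (pi/n)) ^ n)) r = 0" for t r
    using root_le_of_coeffs_le[OF R'(2) _ _ _ root, of "exp (\<gamma> * t)" D] coeff_neg[OF t] D
    unfolding R'(3) by simp
  moreover have "1 + real d * D > 0" using D by (intro add_pos_nonneg) auto
  ultimately show ?thesis unfolding exponent_bound_def \<gamma>_def by blast
qed

lemma negative_ray_reflect:
  assumes "n > 0"
  shows "- ((of_real t * 1) ^ n) = (of_real t * cis (pi/n)) ^ n" "- ((of_real t * cis (pi/n)) ^ n) = (of_real t * 1) ^ n"
  using cis_pi_div_power[OF assms] by (simp_all add: power_mult_distrib)

text \<open>The substitution z -> - z, that is w -> w * cis (pi / n), interchanges the two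
  rays.\<close>

lemma exponent_bound_kink':
  assumes n: "n \<ge> 2" and R: "monic_entire d R"
    and growth: "\<And>w r. poly (R (w^n)) r = 0 \<Longrightarrow> norm r \<le> C * exp (C * norm w)" and C: "C > 0"
    and pos: "exponent_bound n R 1 \<alpha>" and neg: "exponent_bound n R (cis (pi/n)) \<beta>"
  shows "exponent_bound n R 1 ((\<alpha> + \<beta>) / (1 + cos (pi/n)))"
proof -
  have n0: "n > 0" using n by simp
  define S where "S = (\<lambda>z. R (-z))"
  have S: "monic_entire d S"
  proof -
    have "(\<lambda>z. coeff (R (- z)) k) holomorphic_on UNIV" for k
    proof -
      have "(\<lambda>z. coeff (R z) k) \<circ> uminus holomorphic_on UNIV"
        using monic_entireD(1)[OF R]
        by (intro holomorphic_on_compose_gen[of uminus UNIV _ UNIV] holomorphic_intros) (auto simp: entire_coeffs_def)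
      then show ?thesis by (simp add: o_def)
    qed
    then show ?thesis using monic_entireD[OF R] by (auto simp: monic_entire_def S_def entire_coeffs_def)
  qed
  have "exponent_bound n S (cis (pi/n)) ((\<beta> + \<alpha>) / (1 + cos (pi/n)))"
  proof (rule exponent_bound_kink[OF n S _ C])
    fix w r assume "poly (S (w^n)) r = 0"
    then have "poly (R ((w * cis (pi/n)) ^ n)) r = 0"
      using cis_pi_div_power[OF n0] by (simp add: S_def power_mult_distrib)
    from growth[OF this] show "norm r \<le> C * exp (C * norm w)" by (simp add: norm_mult)
  next
    show "exponent_bound n S 1 \<beta>" using neg unfolding exponent_bound_def S_def negative_ray_reflect[OF n0] .
    show "exponent_bound n S (cis (pi/n)) \<alpha>" using pos unfolding exponent_bound_def S_def negative_ray_reflect[OF n0] .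
  qed
  then show ?thesis unfolding exponent_bound_def S_def negative_ray_reflect[OF n0] by (simp only: add.commute)
qed

text \<open>The extremal exponents on the two rays are cosines of an even and an odd multiple of
  \<open>\<pi>/n\<close>; convexity of the growth indicator at both rays is incompatible with every such pair
  except \<open>(1, cos (\<pi>/n))\<close>, the one belonging to the dominant multiplier.\<close>

lemma no_convex_indicator:
  fixes n a c :: nat and \<theta> :: real
  defines "\<theta> \<equiv> pi / real n"
  assumes n: "n \<ge> 2" and a: "even a" "a < 2 * n" and c: "odd c" "c < 2 * n"
    and less1: "cos (a * \<theta>) < 1"
    and conv1: "cos (a * \<theta>) \<ge> cos (c * \<theta>) * cos \<theta>" and conv2: "cos (c * \<theta>) \<ge> cos (a * \<theta>) * cos \<theta>"
  shows False
proof -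
  have n\<theta>: "real n * \<theta> = pi" using n by (simp add: \<theta>_def)
  have \<theta>: "0 < \<theta>" "\<theta> < pi" using n by (auto simp: \<theta>_def field_simps)
  \<comment> \<open>The reflection k -> 2 * n - k preserves both the cosine and the parity, and
    moves the angle into [0, pi], where cosine decreases.\<close>
  have red: "\<exists>k'\<le>n. (even k' \<longleftrightarrow> even k) \<and> cos (k' * \<theta>) = cos (k * \<theta>)" if "k < 2 * n" for k :: nat
  proof (cases "k \<le> n")
    case False
    have "real (2 * n - k) * \<theta> = 2 * pi - k * \<theta>" using that n\<theta> by (simp add: of_nat_diff algebra_simps)
    then have "cos (real (2 * n - k) * \<theta>) = cos (k * \<theta>)" by (simp add: cos_diff)
    then show ?thesis using that False by (intro exI[of _ "2 * n - k"]) auto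
  qed auto
  obtain k where k: "k \<le> n" "even k" "cos (k * \<theta>) = cos (a * \<theta>)" using red[OF a(2)] a(1) by blast
  obtain l where l: "l \<le> n" "odd l" "cos (l * \<theta>) = cos (c * \<theta>)" using red[OF c(2)] c(1) by blast
  \<comment> \<open>Here j >= i + 1, and the addition formula for (i + 1) * \<theta> leaves a
    positive product of sines, since 0 < i < n.\<close>
  have strict: "cos (real j * \<theta>) < cos (real i * \<theta>) * cos \<theta>" if ij: "0 < i" "i < j" "j \<le> n" for i j :: nat
  proof -
    have le: "real (i + 1) * \<theta> \<le> real j * \<theta>" "real j * \<theta> \<le> real n * \<theta>" "real i * \<theta> < real n * \<theta>"
      using ij \<theta> by (auto intro!: mult_right_mono mult_strict_right_mono)
    have "cos (real j * \<theta>) \<le> cos (real (i + 1) * \<theta>)"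
      using le n\<theta> \<theta> by (intro cos_monotone_0_pi_le) auto
    also have "\<dots> = cos (real i * \<theta>) * cos \<theta> - sin (real i * \<theta>) * sin \<theta>"
      by (simp add: algebra_simps cos_add)
    also have "\<dots> < cos (real i * \<theta>) * cos \<theta>"
    proof -
      have "sin (real i * \<theta>) > 0" using le n\<theta> \<theta> ij by (intro sin_gt_zero) auto
      moreover have "sin \<theta> > 0" using \<theta> by (intro sin_gt_zero)
      ultimately show ?thesis by simp
    qed
    finally show ?thesis .
  qed
  \<comment> \<open>This is where the exponent 1 of the dominant multiplier is excluded; the
    remaining degenerate cases l = 0 and k = l are ruled out by parity.\<close>
  have "k \<noteq> 0" using less1 k(3) by (intro notI) auto
  moreover have "l \<noteq> 0" using l(2) by (intro notI) auto
  moreover have "k \<noteq> l" using k(2) l(2) by auto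
  ultimately consider "0 < k" "k < l" | "0 < l" "l < k" by linarith
  then show False
  proof cases
    case 1
    then show False using strict[of k l] l k conv2 by simp
  next
    case 2
    then show False using strict[of l k] l k conv1 by simp
  qed
qed

section \<open>Extremal exponents of a factor\<close>

context fundamental_system
begin

abbreviation "floquet_poly \<equiv> \<lambda>lam. char_poly (floquet lam)"

lemma floquet_poly_monic: "monic_entire n floquet_poly"
  unfolding monic_entire_def
  using entire_coeffs_char_poly[OF floquet_carrier floquet_entry_holomorphic] degree_monic_char_poly[OF floquet_carrier]
  by auto

lemma char_exponent_scale: "char_exponent n (of_real t * e) j = of_real t * char_exponent n e j"
  by (simp add: char_exponent_def)

text \<open>A multiplier in the forbidden annulus would have an exponent c of its own in [lo, hi],
  and the form taken at this very level c rules it out. The threshold is uniform in c because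
  \<epsilon> is.\<close>

lemma multiplier_gap:
  assumes e: "norm e = 1" and eps: "\<epsilon> > 0"
    and gap: "\<And>c j. lo \<le> c \<Longrightarrow> c \<le> hi \<Longrightarrow> j < n \<Longrightarrow> \<bar>Re (char_exponent n e j) - c\<bar> \<ge> \<epsilon>"
  obtains t0 where "t0 \<ge> 1" "\<And>t r. t \<ge> t0 \<Longrightarrow> poly (floquet_poly ((of_real t * e) ^ n)) r = 0 \<Longrightarrow>
     norm r < exp (lo * b * t) \<or> norm r > exp (hi * b * t)"
proof (rule that[of "max 1 (n * coefficient_bound / \<epsilon> + 1)"])
  fix t r assume t: "max 1 (n * coefficient_bound / \<epsilon> + 1) \<le> t"
    and root: "poly (floquet_poly ((of_real t * e) ^ n)) r = 0"
  show "norm r < exp (lo * b * t) \<or> norm r > exp (hi * b * t)"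
  proof (rule ccontr)
    assume "\<not> ?thesis"
    then have r: "exp (lo * b * t) \<le> norm r" "norm r \<le> exp (hi * b * t)" by auto
    have t1: "t \<ge> 1" "t > n * coefficient_bound / \<epsilon>" using t by auto
    have bt: "b * t > 0" using bpos t1 by simp
    have r0: "norm r > 0" using r(1) exp_gt_zero[of "lo * b * t"] by linarith
    define c where "c = ln (norm r) / (b * t)"
    have "c * t * b = ln (norm r)" using bpos t1 by (simp add: c_def)
    then have rc: "norm r = exp (c * t * b)" using r0 by simp
    have "lo * (b * t) \<le> c * (b * t)" "c * (b * t) \<le> hi * (b * t)"
      using r unfolding rc by (simp_all add: mult_ac)
    then have c: "lo \<le> c" "c \<le> hi" using bt by (simp_all only: mult_le_cancel_right_pos)
    have nw: "norm (of_real t * e) = t" using e t1 by (simp add: norm_mult)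
    have "norm r \<noteq> exp (c * norm (of_real t * e) * b)"
    proof (rule multiplier_norm_neq[OF _ _ _ root])
      show "1 \<le> norm (of_real t * e)" "n * coefficient_bound < \<epsilon> * norm (of_real t * e)"
        unfolding nw using t1 eps by (simp_all add: field_simps)
      fix j assume "j < n"
      have "Re (char_exponent n (of_real t * e) j) - c * t = t * (Re (char_exponent n e j) - c)"
        unfolding char_exponent_scale by (simp add: algebra_simps)
      then have "\<bar>Re (char_exponent n (of_real t * e) j) - c * t\<bar> = t * \<bar>Re (char_exponent n e j) - c\<bar>"
        using t1 by (simp add: abs_mult)
      also have "\<dots> \<ge> t * \<epsilon>" using gap[OF c \<open>j < n\<close>] t1 by (intro mult_left_mono) auto
      finally show "\<epsilon> * norm (of_real t * e) \<le> \<bar>Re (char_exponent n (of_real t * e) j) - c * norm (of_real t * e)\<bar>"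
        unfolding nw by (simp add: mult.commute)
    qed
    then show False using rc nw by simp
  qed
qed simp

lemma multiplier_growth:
  obtains C where "C > 0" "\<And>w r. poly (floquet_poly (w ^ n)) r = 0 \<Longrightarrow> norm r \<le> C * exp (C * norm w)"
proof -
  define W where "W = max 1 (n * coefficient_bound + 1)"
  have "compact ((\<lambda>w::complex. w ^ n) ` cball 0 W)"
    by (intro compact_continuous_image continuous_intros) auto
  then obtain B where B: "B > 0" "\<And>z r. z \<in> (\<lambda>w. w ^ n) ` cball 0 W \<Longrightarrow> poly (floquet_poly z) r = 0 \<Longrightarrow> norm r \<le> B"
    using monic_roots_locally_bounded[OF floquet_poly_monic] by metis
  define C where "C = B + 2 * b + 1"
  have C: "C \<ge> 1" "C \<ge> B" "C \<ge> 2 * b" using B(1) bpos by (auto simp: C_def)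
  have "norm r \<le> C * exp (C * norm w)" if root: "poly (floquet_poly (w ^ n)) r = 0" for w r
  proof (cases "norm w \<le> W")
    case True
    have "norm r \<le> B * 1" using B(2)[OF _ root] True by auto
    also have "\<dots> \<le> C * exp (C * norm w)" using C B(1) by (intro mult_mono) auto
    finally show ?thesis .
  next
    case False
    have "norm r < 1 * exp (2 * norm w * b)" using multiplier_norm_less[OF _ _ root] False by (simp add: W_def)
    also have "\<dots> \<le> C * exp (C * norm w)" 
    proof (intro mult_mono)
      have "2 * b * norm w \<le> C * norm w" using C by (intro mult_right_mono) auto
      then show "exp (2 * norm w * b) \<le> exp (C * norm w)" by (simp add: mult_ac)
    qed (use C in auto)
    finally show ?thesis by simp
  qed
  then show ?thesis using that[of C] C by auto
qed

text \<open>If the infimum of the admissible exponents were not one of the finitely many Re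
  \<kappa>, an annulus free of multipliers around it would improve a bound slightly above the
  infimum to one below it.\<close>

lemma extremal_exponent:
  assumes R: "monic_entire d R" "d > 0" and dvd: "\<And>z. R z dvd floquet_poly z" and e: "norm e = 1"
  obtains j where "j < n" "\<And>\<eta>. \<eta> > 0 \<Longrightarrow> exponent_bound n R e ((Re (char_exponent n e j) + \<eta>) * b)"
    "\<And>\<beta>. exponent_bound n R e (\<beta> * b) \<Longrightarrow> Re (char_exponent n e j) \<le> \<beta>"
proof -
  have root: "poly (floquet_poly z) r = 0" if "poly (R z) r = 0" for z r
    using dvd[of z] that by (auto elim!: dvdE)
  define W where "W = max 1 (n * coefficient_bound + 1)"
  define A where "A = {\<alpha>. exponent_bound n R e (\<alpha> * b)}"
  define \<alpha> where "\<alpha> = Inf A"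
  have nw: "norm (of_real t * e) = t" if "t \<ge> W" for t
    using e that by (simp add: norm_mult W_def)
  have "2 \<in> A" unfolding A_def mem_Collect_eq
  proof (rule exponent_bound_of_eventually[OF R(1), of W _ _ 1])
    fix t r assume t: "t \<ge> W" and "poly (R ((of_real t * e) ^ n)) r = 0"
    from multiplier_norm_less[OF _ _ root[OF this(2)]] show "norm r \<le> 1 * exp (2 * b * t)"
      unfolding nw[OF t] using t by (simp add: W_def mult_ac)
  qed
  \<comment> \<open>Since d > 0, R has a root at every point, and this root is a multiplier, hence
    larger than exp (- 2 b t) far out.\<close>
  have lower: "\<beta> \<ge> - 2" if \<beta>: "\<beta> \<in> A" for \<beta>
  proof (rule ccontr)
    assume "\<not> \<beta> \<ge> - 2"
    then have neg: "(\<beta> + 2) * b < 0" using bpos by (simp add: mult_less_0_iff)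
    obtain M where M: "M > 0" "\<And>t r. t \<ge> 0 \<Longrightarrow> poly (R ((of_real t * e) ^ n)) r = 0 \<Longrightarrow> norm r \<le> M * exp (\<beta> * b * t)"
      using \<beta> unfolding A_def exponent_bound_def by auto
    have "filterlim (\<lambda>t. (\<beta> + 2) * b * t) at_bot at_top"
      by (rule filterlim_tendsto_neg_mult_at_bot[OF tendsto_const neg filterlim_ident])
    then have "((\<lambda>t. M * exp ((\<beta> + 2) * b * t)) \<longlongrightarrow> 0) at_top"
      by (intro tendsto_mult_right_zero filterlim_compose[OF exp_at_bot])
    then have "eventually (\<lambda>t. M * exp ((\<beta> + 2) * b * t) < 1) at_top" by (rule order_tendstoD) simp
    then have "eventually (\<lambda>t. M * exp ((\<beta> + 2) * b * t) < 1 \<and> t \<ge> W) at_top"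
      using eventually_ge_at_top by (rule eventually_conj)
    then obtain t where t: "M * exp ((\<beta> + 2) * b * t) < 1" "t \<ge> W"
      using eventually_happens trivial_limit_at_top_linorder by blast
    have "degree (R ((of_real t * e) ^ n)) \<noteq> 0" using monic_entireD(3)[OF R(1)] R(2) by simp
    then obtain r where r: "poly (R ((of_real t * e) ^ n)) r = 0"
      using fundamental_theorem_of_algebra[of "R ((of_real t * e) ^ n)"] by (auto simp: constant_degree)
    have "exp (-2 * t * b) < norm r"
      using multiplier_norm_greater[OF _ _ root[OF r]] t(2) unfolding nw[OF t(2)] by (simp add: W_def)
    also have "norm r \<le> M * exp (\<beta> * b * t)" using t(2) by (intro M(2) r) (simp add: W_def)
    also have "\<dots> = M * exp ((\<beta> + 2) * b * t) * exp (-2 * t * b)"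
      by (simp add: algebra_simps flip: exp_add)
    also have "\<dots> < 1 * exp (-2 * t * b)" using t(1) by (intro mult_strict_right_mono) auto
    finally show False by simp
  qed
  have bdd: "bdd_below A" using lower by (intro bdd_belowI) auto
  have upward: "\<beta>' \<in> A" if \<beta>: "\<beta> \<in> A" "\<beta> \<le> \<beta>'" for \<beta> \<beta>'
  proof -
    obtain M where M: "M > 0" "\<And>t r. t \<ge> 0 \<Longrightarrow> poly (R ((of_real t * e) ^ n)) r = 0 \<Longrightarrow> norm r \<le> M * exp (\<beta> * b * t)"
      using \<beta>(1) unfolding A_def exponent_bound_def by auto
    show ?thesis unfolding A_def mem_Collect_eq
    proof (rule exponent_bound_of_eventually[OF R(1), of 0 _ _ M])
      fix t r assume t: "0 \<le> t" and r: "poly (R ((of_real t * e) ^ n)) r = 0"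
      have "norm r \<le> M * exp (\<beta> * b * t)" by (rule M(2)[OF t r])
      also have "\<dots> \<le> M * exp (\<beta>' * b * t)" using M(1) \<beta>(2) bpos t 
        by (intro mult_left_mono) (auto intro!: mult_right_mono)
      finally show "norm r \<le> M * exp (\<beta>' * b * t)" .
    qed
  qed
  have above: "\<alpha> + \<eta> \<in> A" if "\<eta> > 0" for \<eta>
  proof -
    have "Inf A < \<alpha> + \<eta>" using that by (simp add: \<alpha>_def)
    then obtain \<beta> where "\<beta> \<in> A" "\<beta> < \<alpha> + \<eta>" using \<open>2 \<in> A\<close> bdd by (subst (asm) cInf_less_iff) auto
    then show ?thesis using upward by simp
  qed
  have below: "\<alpha> \<le> \<beta>" if "\<beta> \<in> A" for \<beta>
    unfolding \<alpha>_def using that bdd by (rule cInf_lower)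
  define X where "X = (\<lambda>j. Re (char_exponent n e j)) ` {..<n}"
  have "\<alpha> \<in> X"
  proof (rule ccontr)
    assume "\<alpha> \<notin> X"
    then have "open (- X)" "\<alpha> \<in> - X" unfolding X_def by (auto intro!: finite_imp_closed)
    then obtain \<delta> where \<delta>: "\<delta> > 0" "ball \<alpha> \<delta> \<subseteq> - X" by (meson open_contains_ball)
    \<comment> \<open>The interval from \<alpha> - \<epsilon> to \<alpha> + 2 * \<epsilon> keeps
      distance \<epsilon> from all Re \<kappa>. Its part above \<alpha> + \<epsilon> absorbs the
      constant M for large t.\<close>
    define \<epsilon> where "\<epsilon> = \<delta> / 4"
    have eps: "\<epsilon> > 0" using \<delta> by (simp add: \<epsilon>_def)
    have gap: "\<bar>Re (char_exponent n e j) - c\<bar> \<ge> \<epsilon>" if "\<alpha> - \<epsilon> \<le> c" "c \<le> \<alpha> + 2 * \<epsilon>" "j < n" for c j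
    proof -
      have "Re (char_exponent n e j) \<notin> ball \<alpha> \<delta>" using \<delta>(2) that(3) by (auto simp: X_def)
      then have "\<bar>\<alpha> - Re (char_exponent n e j)\<bar> \<ge> 4 * \<epsilon>" by (simp add: dist_real_def \<epsilon>_def)
      then show ?thesis using that eps by linarith
    qed
    obtain t0 where t0: "t0 \<ge> 1" "\<And>t r. t \<ge> t0 \<Longrightarrow> poly (floquet_poly ((of_real t * e) ^ n)) r = 0 \<Longrightarrow>
       norm r < exp ((\<alpha> - \<epsilon>) * b * t) \<or> norm r > exp ((\<alpha> + 2 * \<epsilon>) * b * t)"
      using multiplier_gap[OF e eps gap] by blast
    obtain M where M: "M > 0" "\<And>t r. t \<ge> 0 \<Longrightarrow> poly (R ((of_real t * e) ^ n)) r = 0 \<Longrightarrow> norm r \<le> M * exp ((\<alpha> + \<epsilon>) * b * t)"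
      using above[OF eps] unfolding A_def exponent_bound_def by auto
    define t1 where "t1 = max t0 (\<bar>ln M\<bar> / (\<epsilon> * b))"
    have "\<alpha> - \<epsilon> \<in> A" unfolding A_def mem_Collect_eq
    proof (rule exponent_bound_of_eventually[OF R(1), of t1 _ _ 1])
      fix t r assume t: "t1 \<le> t" and r: "poly (R ((of_real t * e) ^ n)) r = 0"
      have tt: "t \<ge> t0" "t \<ge> 1" "t \<ge> \<bar>ln M\<bar> / (\<epsilon> * b)" using t t0(1) by (auto simp: t1_def)
      have "ln M \<le> t * (\<epsilon> * b)" using tt(3) eps bpos by (simp add: pos_divide_le_eq)
      then have "M \<le> exp (t * (\<epsilon> * b))" using M(1) by (metis exp_le_cancel_iff exp_ln)
      then have "M * exp ((\<alpha> + \<epsilon>) * b * t) \<le> exp (t * (\<epsilon> * b)) * exp ((\<alpha> + \<epsilon>) * b * t)"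
        by (intro mult_right_mono) auto
      also have "\<dots> = exp ((\<alpha> + 2 * \<epsilon>) * b * t)" by (simp add: algebra_simps flip: exp_add)
      finally have "norm r \<le> exp ((\<alpha> + 2 * \<epsilon>) * b * t)" using M(2)[OF _ r] tt by force
      then show "norm r \<le> 1 * exp ((\<alpha> - \<epsilon>) * b * t)" using t0(2)[OF tt(1) root[OF r]] by auto
    qed
    then show False using below[of "\<alpha> - \<epsilon>"] eps by simp
  qed
  then obtain j where "j < n" "\<alpha> = Re (char_exponent n e j)" by (auto simp: X_def)
  then show ?thesis using that[of j] above below by (simp add: A_def)
qed

text \<open>Because the exponents are extremal, the kink bounds turn back on them: \<beta> <=
  (\<alpha> + \<beta>) / (1 + cos \<theta>), and likewise for \<alpha>. The bound
  \<open>small\<close> excludes \<alpha> = 1.\<close>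

lemma no_factor_without_dominant_multiplier:
  assumes R: "monic_entire d R" "d > 0" and dvd: "\<And>z. R z dvd floquet_poly z" 
    and c: "c < 1" 
    and small: "\<And>t r. t \<ge> t0 \<Longrightarrow> poly (R (of_real t ^ n)) r = 0 \<Longrightarrow> norm r \<le> exp (c * b * t)"
  shows False
proof -
  define \<theta> where "\<theta> = pi / real n"
  have root: "poly (floquet_poly z) r = 0" if "poly (R z) r = 0" for z r
    using dvd[of z] that by (auto elim!: dvdE)
  obtain C where C: "C > 0" "\<And>w r. poly (floquet_poly (w ^ n)) r = 0 \<Longrightarrow> norm r \<le> C * exp (C * norm w)"
    using multiplier_growth by blast
  obtain i where i: "i < n" "\<And>\<eta>. \<eta> > 0 \<Longrightarrow> exponent_bound n R 1 ((Re (char_exponent n 1 i) + \<eta>) * b)"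
    "\<And>\<beta>. exponent_bound n R 1 (\<beta> * b) \<Longrightarrow> Re (char_exponent n 1 i) \<le> \<beta>"
    using extremal_exponent[OF R dvd, of 1] by auto
  obtain j where j: "j < n" "\<And>\<eta>. \<eta> > 0 \<Longrightarrow> exponent_bound n R (cis \<theta>) ((Re (char_exponent n (cis \<theta>) j) + \<eta>) * b)"
    "\<And>\<beta>. exponent_bound n R (cis \<theta>) (\<beta> * b) \<Longrightarrow> Re (char_exponent n (cis \<theta>) j) \<le> \<beta>"
    using extremal_exponent[OF R dvd, of "cis \<theta>"] by auto
  define \<alpha> where "\<alpha> = Re (char_exponent n 1 i)"
  define \<beta> where "\<beta> = Re (char_exponent n (cis \<theta>) j)"
  have \<alpha>: "\<alpha> = cos (real (2 * i) * \<theta>)" unfolding \<alpha>_def char_exponent_def \<theta>_def by (simp add: mult_ac)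
  have \<beta>: "\<beta> = cos (real (2 * j + 1) * \<theta>)" unfolding \<beta>_def char_exponent_def \<theta>_def
    by (simp only: cis_mult cis.sel) (simp add: algebra_simps add_divide_distrib)
  have "exponent_bound n R 1 (c * b)"
    by (rule exponent_bound_of_eventually[OF R(1), of t0 _ _ 1]) (use small in simp)
  then have "\<alpha> < 1" using i(3)[of c] c unfolding \<alpha>_def by linarith
  have "0 \<le> \<theta>" "\<theta> \<le> pi / 2" unfolding \<theta>_def using n2 by (auto simp: field_simps)
  then have th: "cos \<theta> \<ge> 0" by (intro cos_ge_zero) auto
  have ev: "((\<alpha> + \<eta>) * b + (\<beta> + \<eta>) * b) / (1 + cos \<theta>) = (\<alpha> + \<beta> + 2 * \<eta>) / (1 + cos \<theta>) * b" for \<eta>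
    by (simp add: algebra_simps add_divide_distrib)
  have growth: "norm r \<le> C * exp (C * norm w)" if "poly (R (w^n)) r = 0" for w r
    using C(2) root[OF that] by blast
  \<comment> \<open>The margin \<eta> is carried because only exponents strictly above the infimum
    are known to be attained.\<close>
  have b1: "\<beta> * (1 + cos \<theta>) \<le> \<alpha> + \<beta> + \<eta>" if "\<eta> > 0" for \<eta>
  proof -
    have "exponent_bound n R (cis \<theta>) (((\<alpha> + \<eta>/2) * b + (\<beta> + \<eta>/2) * b) / (1 + cos \<theta>))"
      using exponent_bound_kink[OF n2 R(1) growth C(1) i(2) j(2)[unfolded \<theta>_def], of "\<eta>/2" "\<eta>/2"] that
      by (simp add: \<alpha>_def \<beta>_def \<theta>_def)
    then have "\<beta> \<le> (\<alpha> + \<beta> + 2 * (\<eta>/2)) / (1 + cos \<theta>)" unfolding ev by (rule j(3)[folded \<beta>_def])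
    then show ?thesis using th by (simp add: pos_le_divide_eq)
  qed
  have a1: "\<alpha> * (1 + cos \<theta>) \<le> \<alpha> + \<beta> + \<eta>" if "\<eta> > 0" for \<eta>
  proof -
    have "exponent_bound n R 1 (((\<alpha> + \<eta>/2) * b + (\<beta> + \<eta>/2) * b) / (1 + cos \<theta>))"
      using exponent_bound_kink'[OF n2 R(1) growth C(1) i(2) j(2)[unfolded \<theta>_def], of "\<eta>/2" "\<eta>/2"] that
      by (simp add: \<alpha>_def \<beta>_def \<theta>_def)
    then have "\<alpha> \<le> (\<alpha> + \<beta> + 2 * (\<eta>/2)) / (1 + cos \<theta>)" unfolding ev by (rule i(3)[folded \<alpha>_def])
    then show ?thesis using th by (simp add: pos_le_divide_eq)
  qed
  have "\<beta> * (1 + cos \<theta>) \<le> \<alpha> + \<beta>" using b1 by (rule field_le_epsilon)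
  then have conv1: "\<alpha> \<ge> \<beta> * cos \<theta>" by (simp add: algebra_simps)
  have "\<alpha> * (1 + cos \<theta>) \<le> \<alpha> + \<beta>" using a1 by (rule field_le_epsilon)
  then have conv2: "\<beta> \<ge> \<alpha> * cos \<theta>" by (simp add: algebra_simps)
  show False
    by (rule no_convex_indicator[of n "2 * i" "2 * j + 1"])
       (use n2 i(1) j(1) \<open>\<alpha> < 1\<close> conv1 conv2 in \<open>auto simp: \<alpha> \<beta> \<theta>_def\<close>)
qed

end

section \<open>The trace of a factor locates the dominant multiplier\<close>

lemma coeff_prod_linear_factors_subleading:
  fixes rs :: "complex list"
  assumes "rs \<noteq> []"
  shows "coeff (\<Prod>r\<leftarrow>rs. [:- r, 1:]) (length rs - 1) = - sum_list rs"
  using assms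
proof (induction rs)
  case (Cons a rs)
  let ?p = "\<Prod>r\<leftarrow>rs. [:- r, 1:]"
  show ?case
  proof (cases "rs = []")
    case False
    then obtain m where m: "length rs = Suc m" by (cases rs) auto
    have lead: "coeff ?p (length rs) = 1"
      by (induction rs) (auto simp: coeff_eq_0 degree_linear_factors)
    have "coeff (\<Prod>r\<leftarrow>a # rs. [:- r, 1:]) (length rs) = coeff ?p m - a * coeff ?p (length rs)"
      by (simp add: m)
    then show ?thesis using Cons.IH[OF False] lead by (simp add: m)
  qed simp
qed simp

lemma norm_sum_list_le:
  fixes xs :: "complex list" and B :: real
  assumes "\<And>x. x \<in> set xs \<Longrightarrow> norm x \<le> B"
  shows "norm (sum_list xs) \<le> length xs * B"
  using assms
proof (induction xs)
  case (Cons x xs)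
  have "norm (sum_list (x # xs)) \<le> norm x + norm (sum_list xs)" by (simp add: norm_triangle_ineq)
  also have "\<dots> \<le> B + length xs * B" using Cons by (intro add_mono) auto
  finally show ?case by (simp add: algebra_simps)
qed simp

context fundamental_system
begin

text \<open>At most one of two complementary factors carries the dominant multiplier on the positive
  ray, and by continuity of its trace it is eventually always the same one.\<close>

lemma no_monic_entire_factorization:
  assumes Q: "monic_entire d Q" "d > 0" and R: "monic_entire e R" "e > 0"
    and PQR: "\<And>z. floquet_poly z = Q z * R z"
  shows False
proof -
  define \<gamma> where "\<gamma> = cos (2 * pi / n)"
  \<comment> \<open>[\<gamma>, 1] is cut into four pieces with \<open>c\<close> in the middle, so
    the interval from c - \<delta> to c + \<delta> keeps distance \<delta> from the dominant
    exponent 1 and from all others.\<close>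
  define \<delta> where "\<delta> = (1 - \<gamma>) / 4"
  define c where "c = \<gamma> + 2 * \<delta>"
  have "\<gamma> < 1"
  proof -
    have "cos (2 * pi / n) < cos 0" using n2 by (intro cos_monotone_0_pi) (auto simp: field_simps)
    then show ?thesis by (simp add: \<gamma>_def)
  qed
  then have \<delta>: "\<delta> > 0" "4 * \<delta> = 1 - \<gamma>" by (auto simp: \<delta>_def)
  have c: "c = \<gamma> + 2 * \<delta>" "c = 1 - 2 * \<delta>" "c < 1" using \<delta> by (auto simp: c_def)
  have gap: "\<bar>Re (char_exponent n 1 j) - x\<bar> \<ge> \<delta>" if "c - \<delta> \<le> x" "x \<le> c + \<delta>" "j < n" for x j
  proof (cases "j = 0")
    case True
    then show ?thesis using that c \<delta> by (simp add: char_exponent_def)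
  next
    case False
    then have "Re (char_exponent n 1 j) \<le> \<gamma>"
      using cos_multiple_le[of j n] that(3) by (simp add: char_exponent_def \<gamma>_def)
    then show ?thesis using that c \<delta> by linarith
  qed
  obtain t0 where t0: "t0 \<ge> 1" "\<And>t r. t \<ge> t0 \<Longrightarrow> poly (floquet_poly ((of_real t * 1) ^ n)) r = 0 \<Longrightarrow>
     norm r < exp ((c - \<delta>) * b * t) \<or> norm r > exp ((c + \<delta>) * b * t)"
    using multiplier_gap[OF norm_one \<delta>(1) gap] by blast
  \<comment> \<open>Besides the gap and simplicity, \<open>t1\<close> secures \<delta> * b * t > d,
    hence exp (\<delta> * b * t) > d + 1: one dominant root then outweighs all others in the
    trace.\<close>
  define t1 where "t1 = max t0 (max (n * coefficient_bound / \<delta> + 1) (d / (\<delta> * b) + 1))"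
  have large: "t \<ge> t0" "t \<ge> 1" "\<delta> * t > n * coefficient_bound" "\<delta> * b * t > d" if "t \<ge> t1" for t
  proof -
    show "t \<ge> t0" "t \<ge> 1" using that t0(1) by (auto simp: t1_def)
    have "t > n * coefficient_bound / \<delta>" "t > d / (\<delta> * b)" using that by (auto simp: t1_def)
    then show "\<delta> * t > n * coefficient_bound" "\<delta> * b * t > d"
      using \<delta>(1) bpos by (simp_all add: pos_divide_less_eq mult_ac)
  qed
  define dominant where "dominant = (\<lambda>(S :: complex \<Rightarrow> complex poly) t. \<exists>r. poly (S (of_real t ^ n)) r = 0 \<and> exp (c * b * t) \<le> norm r)"
  have simple: False 
    if "t \<ge> t1" "floquet_poly (of_real t ^ n) = (\<Prod>x\<leftarrow>r1 # r2 # es. [:- x, 1:])"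
      "exp (c * b * t) \<le> norm r1" "exp (c * b * t) \<le> norm r2" for t r1 r2 es
  proof (rule dominant_multiplier_simple[OF large(2,3)[OF that(1)] \<delta>(1) _ _ that(2)])
    show "exp (c * t * b) \<le> norm r1" "exp (c * t * b) \<le> norm r2"
      using that(3,4) by (simp_all only: mult.assoc mult.commute[of t])
    show "c \<le> 1 - \<delta>" "cos (2 * pi / n) + \<delta> \<le> c"
      using c \<delta> unfolding \<gamma>_def[symmetric] by linarith+
  qed
  have split: "(\<Prod>x\<leftarrow>xs. [:- x, 1:]) = [:- y, 1:] * (\<Prod>x\<leftarrow>remove1 y xs. [:- x, 1:])" 
    if "y \<in> set xs" for y :: complex and xs
    using prod_list_map_remove1[OF that, of "\<lambda>x. [:- x, 1:]"] .
  have not_both: "\<not> (dominant Q t \<and> dominant R t)" if t: "t \<ge> t1" for t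
  proof
    assume "dominant Q t \<and> dominant R t"
    then obtain r1 r2 where r1: "poly (Q (of_real t ^ n)) r1 = 0" "exp (c * b * t) \<le> norm r1"
      and r2: "poly (R (of_real t ^ n)) r2 = 0" "exp (c * b * t) \<le> norm r2" by (auto simp: dominant_def)
    obtain qs where qs: "Q (of_real t ^ n) = (\<Prod>x\<leftarrow>qs. [:- x, 1:])" "\<And>x. poly (Q (of_real t ^ n)) x = 0 \<longleftrightarrow> x \<in> set qs"
      using monic_poly_linear_factors[OF monic_entireD(2)[OF Q(1)]] by metis
    obtain rs where rs: "R (of_real t ^ n) = (\<Prod>x\<leftarrow>rs. [:- x, 1:])" "\<And>x. poly (R (of_real t ^ n)) x = 0 \<longleftrightarrow> x \<in> set rs"
      using monic_poly_linear_factors[OF monic_entireD(2)[OF R(1)]] by metis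
    have "floquet_poly (of_real t ^ n) = (\<Prod>x\<leftarrow>r1 # r2 # (remove1 r1 qs @ remove1 r2 rs). [:- x, 1:])"
      unfolding PQR qs(1) rs(1) using split[of r1 qs] split[of r2 rs] qs(2) rs(2) r1(1) r2(1)
      by (simp only: list.map map_append prod_list.Cons prod_list.append mult_ac)
    from simple[OF t this r1(2) r2(2)] show False .
  qed
  \<comment> \<open>The modulus of the trace of Q relative to the level. It is continuous and
    distinguishes whether Q has a dominant root, so no individual root has to be followed in
    t.\<close>
  define \<psi> where "\<psi> = (\<lambda>t. norm (coeff (Q (of_real t ^ n)) (d - 1)) * exp (- (c * b * t)))"
  have \<psi>_dominant: "if dominant Q t then \<psi> t > 1 else \<psi> t < 1" if t: "t \<ge> t1" for t
  proof -
    let ?z = "of_real t ^ n :: complex"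
    define E where "E = exp (c * b * t)"
    define x where "x = exp (\<delta> * b * t)"
    have E: "E > 0" by (simp add: E_def)
    have x: "x > d + 1"
      using exp_ge_add_one_self[of "\<delta> * b * t"] large(4)[OF t] unfolding x_def by linarith
    have x0: "x > 0" using x by linarith
    have Ex: "exp ((c - \<delta>) * b * t) = E / x" "exp ((c + \<delta>) * b * t) = E * x"
      by (simp_all add: E_def x_def algebra_simps exp_add exp_diff)
    have dichotomy: "norm r < E / x \<or> norm r > E * x" if "poly (Q ?z) r = 0" for r
      using t0(2)[OF large(1)[OF t], of r] that unfolding Ex by (simp add: PQR)
    have "E * 1 \<le> E * x" using E x by (intro mult_left_mono) linarith+
    then have EE: "E / x \<le> E" "E \<le> E * x" using x0 by (simp_all add: pos_divide_le_eq)
    obtain qs where qs: "Q ?z = (\<Prod>x\<leftarrow>qs. [:- x, 1:])" "length qs = degree (Q ?z)" 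
      "\<And>x. poly (Q ?z) x = 0 \<longleftrightarrow> x \<in> set qs"
      using monic_poly_linear_factors[OF monic_entireD(2)[OF Q(1)]] by metis
    have len: "length qs = d" using qs(2) monic_entireD(3)[OF Q(1)] by simp
    then have "coeff (Q ?z) (d - 1) = - sum_list qs"
      unfolding qs(1) using coeff_prod_linear_factors_subleading[of qs] Q(2) by force
    then have \<psi>: "\<psi> t = norm (sum_list qs) / E" by (simp add: \<psi>_def E_def exp_minus field_simps)
    show ?thesis
    proof (cases "dominant Q t")
      case True
      then obtain r1 where r1: "r1 \<in> set qs" "E \<le> norm r1" by (auto simp: dominant_def qs(3) E_def)
      have r1x: "norm r1 > E * x" using dichotomy[of r1] r1 EE by (auto simp: qs(3))
      \<comment> \<open>\<open>remove1\<close> keeps multiplicities: a second root above the level,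
        even a repetition of r1, contradicts simplicity.\<close>
      have others: "norm r2 \<le> E / x" if "r2 \<in> set (remove1 r1 qs)" for r2
      proof -
        have "r2 \<in> set qs" using that set_remove1_subset by fast
        moreover have "\<not> E \<le> norm r2"
        proof
          assume r2: "E \<le> norm r2"
          obtain rs where rs: "R ?z = (\<Prod>x\<leftarrow>rs. [:- x, 1:])"
            using monic_poly_linear_factors[OF monic_entireD(2)[OF R(1)]] by metis
          have "floquet_poly ?z = (\<Prod>x\<leftarrow>r1 # r2 # (remove1 r2 (remove1 r1 qs) @ rs). [:- x, 1:])"
            unfolding PQR qs(1) rs(1) using split[OF r1(1)] split[OF that]
            by (simp only: list.map map_append prod_list.Cons prod_list.append mult_ac)
          from simple[OF t this] r1(2) r2 show False by (simp add: E_def)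
        qed
        ultimately show ?thesis using dichotomy[of r2] EE by (auto simp: qs(3))
      qed
      have "sum_list qs = r1 + sum_list (remove1 r1 qs)" 
        using sum_list_map_remove1[OF r1(1), of "\<lambda>x. x"] by simp
      then have "norm r1 \<le> norm (sum_list qs) + norm (sum_list (remove1 r1 qs))"
        using norm_triangle_ineq4[of "sum_list qs" "sum_list (remove1 r1 qs)"] by simp
      moreover have "norm (sum_list (remove1 r1 qs)) \<le> length (remove1 r1 qs) * (E / x)"
        using others by (rule norm_sum_list_le)
      moreover have "length (remove1 r1 qs) * (E / x) \<le> d * (E / x)"
        using len E x0 by (intro mult_right_mono) (auto simp: length_remove1)
      ultimately have "norm (sum_list qs) > E * x - d * (E / x)" using r1x by linarith
      then have "\<psi> t > x - d / x" unfolding \<psi> using E by (simp add: field_simps)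
      moreover have "d / x < 1" using x by (simp add: divide_less_eq)
      moreover have "x > 2" using x Q(2) by linarith
      ultimately have "\<psi> t > 1" by linarith
      then show ?thesis using True by simp
    next
      case False
      have "norm r \<le> E / x" if "r \<in> set qs" for r
        using dichotomy[of r] that False EE by (auto simp: qs(3) dominant_def E_def[symmetric])
      then have "norm (sum_list qs) \<le> d * (E / x)" using norm_sum_list_le[of qs "E / x"] len by simp
      then have "\<psi> t \<le> d / x" unfolding \<psi> using E by (simp add: field_simps)
      moreover have "d / x < 1" using x by (simp add: divide_less_eq)
      ultimately have "\<psi> t < 1" by linarith
      then show ?thesis using False by simp
    qed
  qed
  have "continuous_on {t1..} \<psi>" unfolding \<psi>_def
    by (intro continuous_intros continuous_on_compose2[OF entire_coeffs_continuous[OF monic_entireD(1)[OF Q(1)], of UNIV]]) auto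
  then have conn: "connected (\<psi> ` {t1..})" by (intro connected_continuous_image) auto
  \<comment> \<open>\<psi> never takes the value 1 on the connected ray, so it stays on one
    side.\<close>
  have const: "dominant Q s = dominant Q t" if s: "s \<ge> t1" and t: "t \<ge> t1" for s t
  proof (rule ccontr)
    assume "dominant Q s \<noteq> dominant Q t"
    then obtain s' t' where st: "s' \<ge> t1" "t' \<ge> t1" "\<psi> s' < 1" "\<psi> t' > 1"
      using \<psi>_dominant[OF s] \<psi>_dominant[OF t] s t by (cases "dominant Q s") auto
    have "1 \<in> \<psi> ` {t1..}"
      by (rule connectedD_interval[OF conn, of "\<psi> s'" "\<psi> t'"]) (use st in auto)
    then obtain x where "x \<ge> t1" "\<psi> x = 1" by auto
    then show False using \<psi>_dominant[of x] by (auto split: if_splits)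
  qed
  have dvd: "Q z dvd floquet_poly z" "R z dvd floquet_poly z" for z by (simp_all add: PQR)
  show False
  proof (cases "dominant Q t1")
    case False
    then have "\<not> dominant Q t" if "t \<ge> t1" for t using const[of t t1] that by simp
    then show False
      using no_factor_without_dominant_multiplier[OF Q dvd(1) c(3), of t1] by (force simp: dominant_def)
  next
    case True
    then have "\<not> dominant R t" if "t \<ge> t1" for t using const[of t t1] not_both[of t] that by simp
    then show False
      using no_factor_without_dominant_multiplier[OF R dvd(2) c(3), of t1] by (force simp: dominant_def)
  qed
qed

lemma floquet_poly_irreducible: "mero_irreducible floquet_poly"
  unfolding mero_irreducible_def
proof (intro conjI notI)
  note P = monic_entireD[OF floquet_poly_monic]
  have "(\<lambda>z. coeff (floquet_poly z) k) meromorphic_on UNIV" for k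
    using P(1) by (intro analytic_on_imp_meromorphic_on) (simp add: entire_coeffs_def analytic_on_open)
  then show "mero_poly floquet_poly" unfolding mero_poly_def using P(3) by auto
  have "coeff (floquet_poly z) n = 1" for z using P(2)[of z] P(3)[of z] by simp
  then show "mero_deg_pos floquet_poly" unfolding mero_deg_pos_def using n2 by (intro exI[of _ n]) auto
  assume "\<exists>Q R. mero_poly Q \<and> mero_poly R \<and> mero_deg_pos Q \<and> mero_deg_pos R \<and>
            (\<forall>\<^sub>\<approx>z. floquet_poly z = Q z * R z)"
  then obtain Q R where QR: "mero_poly Q" "mero_deg_pos Q" "mero_poly R" "mero_deg_pos R"
    "\<forall>\<^sub>\<approx>z. floquet_poly z = Q z * R z" by blast
  from monic_entire_factorization[OF floquet_poly_monic QR] no_monic_entire_factorization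
  show False by metis
qed

end

theorem theorem2:
  fixes n :: nat and b :: real
    and p :: "nat \<Rightarrow> real \<Rightarrow> complex"
    and u :: "nat \<Rightarrow> complex \<Rightarrow> real \<Rightarrow> complex"
  assumes n2: "n \<ge> 2" and bpos: "b > 0"
    and p_smooth: "\<And>k. k \<le> n - 2 \<Longrightarrow> smooth_fun (p k)"
    and p_periodic: "\<And>k x. k \<le> n - 2 \<Longrightarrow> p k (x + b) = p k x"
    and u_diff: "\<And>j lam. j < n \<Longrightarrow> differentiable_n n (u j lam)"
    and u_ode: "\<And>j lam x. j < n \<Longrightarrow>
        vderiv n (u j lam) x + (\<Sum>k\<le>n - 2. p k x * vderiv k (u j lam) x) = lam * u j lam x"
    and u_init: "\<And>i j lam. i < n \<Longrightarrow> j < n \<Longrightarrow>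
        vderiv i (u j lam) 0 = (if i = j then 1 else 0)"
  shows "mero_irreducible
           (\<lambda>lam. char_poly (mat n n (\<lambda>(i, j). vderiv i (u j lam) b)))"
proof -
  interpret fundamental_system n b p u
    by unfold_locales (fact n2 bpos p_smooth u_diff u_ode u_init)+
  show ?thesis using floquet_poly_irreducible unfolding floquet_def .
qed

end
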